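(* Let $\mu\subseteq\lambda$ be partitions and $T\in\mathsf{SVT}^m(\lambda/\mu)$. Let $(\widetilde{P},\widetilde{Q})=\mathsf{uncrowd}(T)$ and let $(P,Q)=\tilde\star(\mathsf{res}(T))$. Then $Q=\widetilde{P}$.
   Context: Tableaux are in French notation; cell $(i,j)$ is in row $i$ (from the bottom), column $j$. $\mathsf{SVT}^m(\lambda/\mu)$: fillings of the cells of $\lambda/\mu$ by nonempty subsets of $[m]$ with $\max(A)\leqslant\min(B)$ for horizontally adjacent $A$ left of $B$ and $\max(A)<\min(C)$ for vertically adjacent $A$ below $C$. A multicell is a cell containing more than one entry. Residue map on a set-valued tableau $S$ of shape $\kappa/\rho$ with entries in $[M]$: cell $(i,j)$ has content $\ell(\kappa)+j-i$; $\mathsf{res}(S)=h^M\cdots h^1$, with $h^k$ the decreasing list of contents of cells containing $k$. Uncrowding: the uncrowding operation on a set-valued tableau finds the topmost row $r$ containing a multicell, deletes the largest letter $x$ of row $r$ that lies in a multicell, and inserts $x$ by ordinary RSK row bumping into the rows above row $r$ ($x$ bumps the smallest entry strictly greater than $x$ in the next row up, which is then inserted into the following row, and so on, until a letter is appended at the end of a row). $\mathsf{uncrowd}(T)=(\widetilde{P},\widetilde{Q})$, where $\widetilde{P}$ is the semistandard (single-valued) skew tableau obtained from $T$ by applying uncrowding operations until no multicells remain, and $\widetilde{Q}$ records the added cells (not needed here). $\star$-insertion of a decreasing factorization $h^M\cdots h^1$ whose concatenation is fully-commutative in the 0-Hecke monoid: list pairs (factor index $q$, letter $x$) for the letters of $h^M$,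 then $h^{M-1}$, ..., then $h^1$, in written order, and process them from last to first starting with empty tableaux $P^*,Q^*$: insert $x$ into the bottom row of $P^*$, where inserting $x$ into a row $R$ means: Case 1: if $R$ is empty or $x>\max(R)$, append $x$, add a cell with entry $q$ to $Q^*$ at the same position, stop; Case 2: otherwise if $x\notin R$, replace the smallest $y\in R$ with $y>x$ by $x$ and insert $y$ into the next row up; Case 3: if $x\in R$, leave $R$ unchanged and insert into the next row up the smallest $y\in R$ with $[y,x]\subseteq R$. Modified insertion $\tilde\star$: let $T_\mu$ be the tableau of shape $\mu$ whose row $i$ is filled with $i$'s. Let $T^*$ be the set-valued tableau of shape $\lambda$ obtained by filling the cells of $\mu$ with $T_\mu$ and adding $\ell(\mu)$ to every entry of $T$ in the cells of $\lambda/\mu$ (so $\mathsf{res}(T^* )$ is $\mathsf{res}(T)$ followed by $\mathsf{res}(T_\mu)$, all contents taken in $\lambda$). Let $(P^*,Q^* )$ be the $\star$-insertion of $\mathsf{res}(T^* )$. Then $\tilde\star(\mathsf{res}(T))=(P,Q)$, where $P$ is obtained from $P^*$ by deleting the entries in the cells of $\mu$, and $Q$ is obtained from $Q^*$ by deleting the cells of $\mu$ and decreasing every remaining entry by $\ell(\mu)$. *)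

theory Defs
  imports Main "HOL-Library.While_Combinator"
begin

text \<open>
  A partition is the list of its (positive) parts. Cells are pairs \<open>(r, c)\<close> of a row, counted
  from the bottom, and a column, both counted from 0; so the cell written \<open>(i, j)\<close> with
  indices counted from 1 is \<open>(i - 1, j - 1)\<close>, and \<open>j - i = c - r\<close>.
\<close>

definition is_partition :: "nat list \<Rightarrow> bool" where
  "is_partition lam \<longleftrightarrow> sorted_wrt (\<ge>) lam \<and> 0 \<notin> set lam"

definition part :: "nat list \<Rightarrow> nat \<Rightarrow> nat" where
  "part lam r = (if r < length lam then lam ! r else 0)"

definition subpartition :: "nat list \<Rightarrow> nat list \<Rightarrow> bool" where
  "subpartition mu lam \<longleftrightarrow> (\<forall>r. part mu r \<le> part lam r)"

definition skew_cells :: "nat list \<Rightarrow> nat list \<Rightarrow> (nat \<times> nat) set" where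
  "skew_cells lam mu = (SIGMA r : {..<length lam}. {part mu r..<part lam r})"

text \<open>
  A skew tableau with inner shape \<open>mu\<close> is the list of its rows, bottom row first. The list for
  row \<open>r\<close> holds only the cells outside \<open>mu\<close>, so its \<open>k\<close>-th entry sits in column
  \<open>part mu r + k\<close>; the list is empty if the row has no cell outside \<open>mu\<close>. For a fixed
  inner shape, equality of such lists is equality of both shape and entries.
\<close>

definition entry :: "nat list \<Rightarrow> 'a list list \<Rightarrow> nat \<times> nat \<Rightarrow> 'a" where
  "entry mu T = (\<lambda>(r, c). T ! r ! (c - part mu r))"

definition SVT :: "nat \<Rightarrow> nat list \<Rightarrow> nat list \<Rightarrow> nat set list list set" where
  "SVT m lam mu = {T.
     length T = length lam \<and>
     (\<forall>r < length lam. length (T ! r) = part lam r - part mu r) \<and>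
     (\<forall>z \<in> skew_cells lam mu. entry mu T z \<noteq> {} \<and> entry mu T z \<subseteq> {1..m}) \<and>
     (\<forall>(r, c) \<in> skew_cells lam mu. (r, Suc c) \<in> skew_cells lam mu \<longrightarrow>
        Max (entry mu T (r, c)) \<le> Min (entry mu T (r, Suc c))) \<and>
     (\<forall>(r, c) \<in> skew_cells lam mu. (Suc r, c) \<in> skew_cells lam mu \<longrightarrow>
        Max (entry mu T (r, c)) < Min (entry mu T (Suc r, c)))}"

subsection \<open>Residue map\<close>

definition content :: "nat list \<Rightarrow> nat \<times> nat \<Rightarrow> nat" where
  "content kap = (\<lambda>(r, c). length kap + c - r)"

text \<open>
  The factorization \<open>h\<^sup>M \<dots> h\<^sup>1\<close> is the list \<open>[h\<^sup>M, \<dots>, h\<^sup>1]\<close>. A letter occurs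
  at most once on each diagonal of a set-valued tableau, so the contents listed in a factor are
  distinct and nothing is lost by forming their set.
\<close>

definition residue :: "nat list \<Rightarrow> nat list \<Rightarrow> nat \<Rightarrow> nat set list list \<Rightarrow> nat list list" where
  "residue kap rho M S =
     map (\<lambda>k. rev (sorted_list_of_set
                (content kap ` {z \<in> skew_cells kap rho. k \<in> entry rho S z})))
       (rev [1..<Suc M])"

subsection \<open>Uncrowding\<close>

definition multicell :: "nat set \<Rightarrow> bool" where
  "multicell A \<longleftrightarrow> card A > 1"

definition has_multicell :: "nat set list list \<Rightarrow> bool" where
  "has_multicell T \<longleftrightarrow> (\<exists>R \<in> set T. \<exists>A \<in> set R. multicell A)"

text \<open>
  Bumping takes place only in rows all of whose cells are singletons; there the leftmost cell
  containing the bumped letter \<open>y\<close> becomes \<open>{x}\<close>.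
\<close>

definition bump_row :: "nat \<Rightarrow> nat set list \<Rightarrow> nat set list \<times> nat option" where
  "bump_row x R =
     (let G = {y \<in> \<Union>(set R). x < y} in
      if G = {} then (R @ [{x}], None)
      else let y = Min G; k = Min {k \<in> {..<length R}. y \<in> R ! k}
           in (R[k := insert x (R ! k - {y})], Some y))"

fun bump_rows :: "nat \<Rightarrow> nat set list list \<Rightarrow> nat set list list" where
  "bump_rows x [] = [[{x}]]"
| "bump_rows x (R # Rs) =
     (case bump_row x R of
        (R', None) \<Rightarrow> R' # Rs
      | (R', Some y) \<Rightarrow> R' # bump_rows y Rs)"

text \<open>
  In a set-valued tableau the largest letter of a row lying in a multicell lies in only one
  multicell of that row, so exactly one occurrence is deleted.
\<close>

definition uncrowd_step :: "nat set list list \<Rightarrow> nat set list list" where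
  "uncrowd_step T =
     (let r = Max {r \<in> {..<length T}. \<exists>A \<in> set (T ! r). multicell A};
          x = Max (\<Union>{A \<in> set (T ! r). multicell A})
      in take r T
         @ map (\<lambda>A. if multicell A then A - {x} else A) (T ! r)
         # bump_rows x (drop (Suc r) T))"

text \<open>The first component of uncrowding, a single-valued tableau of the same inner shape.\<close>

definition uncrowd_P :: "nat set list list \<Rightarrow> nat list list" where
  "uncrowd_P T = map (map the_elem) (while has_multicell uncrowd_step T)"

subsection \<open>Star insertion\<close>

definition star_row :: "nat \<Rightarrow> nat list \<Rightarrow> nat list \<times> nat option" where
  "star_row x R =
     (if R = [] \<or> x > Max (set R) then (R @ [x], None)
      else if x \<notin> set R then
        (let y = Min {y \<in> set R. y > x} in (map (\<lambda>z. if z = y then x else z) R, Some y))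
      else (R, Some (Min {y \<in> set R. y \<le> x \<and> {y..x} \<subseteq> set R})))"

text \<open>The second component of \<open>star_rows x P\<close> is the row in which the new cell is created.\<close>

fun star_rows :: "nat \<Rightarrow> nat list list \<Rightarrow> nat list list \<times> nat" where
  "star_rows x [] = ([[x]], 0)"
| "star_rows x (R # Rs) =
     (case star_row x R of
        (R', None) \<Rightarrow> (R' # Rs, 0)
      | (R', Some y) \<Rightarrow> (let (Rs', r) = star_rows y Rs in (R' # Rs', Suc r)))"

definition add_cell :: "nat \<Rightarrow> 'a \<Rightarrow> 'a list list \<Rightarrow> 'a list list" where
  "add_cell r q Q = (if r < length Q then Q[r := Q ! r @ [q]] else Q @ [[q]])"

definition star_step ::
  "nat \<times> nat \<Rightarrow> nat list list \<times> nat list list \<Rightarrow> nat list list \<times> nat list list" where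
  "star_step = (\<lambda>(q, x) (P, Q). let (P', r) = star_rows x P in (P', add_cell r q Q))"

definition factor_pairs :: "nat list list \<Rightarrow> (nat \<times> nat) list" where
  "factor_pairs H = concat (map2 (\<lambda>q h. map (Pair q) h) (rev [1..<Suc (length H)]) H)"

definition star_insertion :: "nat list list \<Rightarrow> nat list list \<times> nat list list" where
  "star_insertion H = foldr star_step (factor_pairs H) ([], [])"

subsection \<open>Modified star insertion\<close>

text \<open>The straight-shape set-valued tableau \<open>T\<^sup>*\<close>, with inner shape \<open>[]\<close>.\<close>

definition fill_inner :: "nat list \<Rightarrow> nat set list list \<Rightarrow> nat set list list" where
  "fill_inner mu T =
     map (\<lambda>r. replicate (part mu r) {Suc r} @ map (\<lambda>A. (\<lambda>a. a + length mu) ` A) (T ! r))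
       [0..<length T]"

definition delete_inner :: "nat list \<Rightarrow> 'a list list \<Rightarrow> 'a list list" where
  "delete_inner mu X = map (\<lambda>r. drop (part mu r) (X ! r)) [0..<length X]"

text \<open>
  The value of the modified insertion on the residue word of \<open>T\<close>, where \<open>T\<close> has shape
  \<open>lam/mu\<close> and entries in \<open>{1..m}\<close>.
\<close>

definition mod_star_residue ::
  "nat list \<Rightarrow> nat list \<Rightarrow> nat \<Rightarrow> nat set list list \<Rightarrow> nat list list \<times> nat list list" where
  "mod_star_residue lam mu m T =
     (let (P, Q) = star_insertion (residue lam [] (m + length mu) (fill_inner mu T))
      in (delete_inner mu P, map (map (\<lambda>q. q - length mu)) (delete_inner mu Q)))"

end

theory Submission
  imports Defs
begin

text \<open>
  Filling the inner shape reduces the claim to a straight set-valued tableau \<open>S\<close> with \<open>l\<close> rows.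
  Build \<open>S\<close> by adding its entries ordered by letter and then by content, which is the order in
  which \<open>\<star>\<close>-insertion reads the residue word. For every \<open>r\<close> let \<open>U r\<close> be the uncrowding of the
  rows of \<open>S\<close> from \<open>r\<close> upwards: it consists of the minima of row \<open>r\<close> below the tableau obtained
  by inserting the remaining letters of row \<open>r\<close>, in decreasing order, into \<open>U (r + 1)\<close>. Write
  \<open>a r i\<close> for the length of its \<open>i\<close>-th row. At every time \<open>Q\<^sup>* = U 0\<close>, and the entry of \<open>P\<^sup>*\<close> in
  row \<open>i\<close> and column \<open>j\<close> is \<open>l + j\<close> minus the number of \<open>r \<ge> 1\<close> with \<open>j < a r i\<close>.

  When a letter \<open>k\<close> is added to row \<open>n\<close> of \<open>S\<close>, each \<open>U r\<close> with \<open>r \<le> n\<close> receives one \<open>k\<close>, at the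
  end of some row \<open>J r\<close>. The remaining letters of row \<open>r\<close> create at most one cell in each row, and
  \<open>k\<close> is pushed upwards exactly past those cells, so that \<open>J r\<close> is the least \<open>j > J (r + 1)\<close> with
  \<open>a r j = a (r + 1) (j - 1)\<close>. The bumping path of \<open>\<star>\<close>-insertion follows the same rule: a row
  \<open>j\<close> with \<open>a r j = a (r + 1) (j - 1) + 1\<close> is an instance of case 3 and stays unchanged, and in
  the first row where equality holds the letter is a new one and bumps the first letter of the
  next block.
\<close>

subsection \<open>Row insertion in the presence of a largest letter\<close>

fun subst_first :: "'a \<Rightarrow> 'a \<Rightarrow> 'a list \<Rightarrow> 'a list" where
  "subst_first y x [] = []"
| "subst_first y x (z # zs) = (if z = y then x # zs else z # subst_first y x zs)"

lemma subst_first_append: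
  "subst_first y x (R @ S) =
     (if y \<in> set R then subst_first y x R @ S else R @ subst_first y x S)"
  by (induction R) auto

lemma length_subst_first [simp]: "length (subst_first y x R) = length R"
  by (induction R) auto

lemma set_subst_first_subset: "set (subst_first y x R) \<subseteq> insert x (set R)"
  by (induction R) auto

text \<open>Rows are not assumed to be sorted, so the leftmost occurrence of the bumped letter is
  replaced, as \<open>bump_row\<close> does on singleton cells.\<close>

definition row_bump :: "nat \<Rightarrow> nat list \<Rightarrow> nat list \<times> nat option" where
  "row_bump x R =
     (if \<exists>y\<in>set R. x < y
      then let y = Min {y \<in> set R. x < y} in (subst_first y x R, Some y)
      else (R @ [x], None))"

fun ins_rows :: "nat \<Rightarrow> nat list list \<Rightarrow> nat list list \<times> nat" where
  "ins_rows x [] = ([[x]], 0)"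
| "ins_rows x (R # Rs) =
     (case row_bump x R of
        (R', None) \<Rightarrow> (R' # Rs, 0)
      | (R', Some y) \<Rightarrow> (let (Rs', r) = ins_rows y Rs in (R' # Rs', Suc r)))"

fun ins_word :: "nat list \<Rightarrow> nat list list \<Rightarrow> nat list list \<times> nat list" where
  "ins_word [] V = (V, [])"
| "ins_word (x # xs) V =
     (let (V', s) = ins_rows x V; (W, ss) = ins_word xs V' in (W, s # ss))"

text \<open>Extended by zero above the top row, so that shapes with different numbers of rows
  compare as functions.\<close>

definition row_len :: "'a list list \<Rightarrow> nat \<Rightarrow> nat" where
  "row_len V i = (if i < length V then length (V ! i) else 0)"

lemma row_len_Nil [simp]: "row_len [] i = 0"
  and row_len_Cons_0 [simp]: "row_len (R # V) 0 = length R"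
  and row_len_Cons_Suc [simp]: "row_len (R # V) (Suc i) = row_len V i"
  by (auto simp: row_len_def)

lemma add_cell_Nil [simp]: "add_cell i k [] = [[k]]"
  and add_cell_Cons_0 [simp]: "add_cell 0 k (R # V) = (R @ [k]) # V"
  and add_cell_Cons_Suc [simp]: "add_cell (Suc i) k (R # V) = R # add_cell i k V"
  by (auto simp: add_cell_def)

lemma row_len_add_cell:
  "i \<le> length V \<Longrightarrow> row_len (add_cell i k V) j = row_len V j + (if j = i then 1 else 0)"
  by (auto simp: row_len_def add_cell_def nth_append nth_list_update)

lemma length_add_cell:
  "i \<le> length V \<Longrightarrow> length (add_cell i k V) = max (length V) (Suc i)"
  by (auto simp: add_cell_def)

lemma row_bump_None: "row_bump x R = (R', None) \<longleftrightarrow> (\<forall>y\<in>set R. y \<le> x) \<and> R' = R @ [x]"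
  by (force simp: row_bump_def Let_def not_less[symmetric])

lemma row_bump_Some:
  "row_bump x R = (R', Some y) \<longleftrightarrow>
     (\<exists>y\<in>set R. x < y) \<and> y = Min {y \<in> set R. x < y} \<and> R' = subst_first y x R"
  by (simp add: row_bump_def Let_def) metis

lemma Min_greater:
  assumes "\<exists>y\<in>set R. x < y"
  shows "Min {y \<in> set R. x < y} \<in> set R" "x < Min {y \<in> set R. x < (y::nat)}"
proof -
  have "Min {y \<in> set R. x < y} \<in> {y \<in> set R. x < y}"
    using assms by (intro Min_in) auto
  then show "Min {y \<in> set R. x < y} \<in> set R" "x < Min {y \<in> set R. x < y}" by auto
qed

lemma row_len_ins_rows:
  assumes "ins_rows x V = (W, s)"
  shows "s \<le> length V \<and> length V \<le> length W \<and>
         row_len W i = row_len V i + (if i = s then 1 else 0)"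
  using assms
proof (induction V arbitrary: x W s i)
  case Nil
  then show ?case by (cases i) auto
next
  case (Cons R V)
  obtain R' o' where b: "row_bump x R = (R', o')" by fastforce
  show ?case
  proof (cases o')
    case None
    then show ?thesis using Cons.prems b by (cases i) (auto simp: row_bump_None)
  next
    case (Some y)
    obtain V' r where V': "ins_rows y V = (V', r)" by fastforce
    have "length R' = length R" using b Some by (auto simp: row_bump_Some)
    then show ?thesis
      using Cons.prems b Some V' Cons.IH[OF V', of "i - 1"] by (cases i) auto
  qed
qed

lemma row_len_ins_word:
  assumes "ins_word xs V = (W, ss)"
  shows "length V \<le> length W \<and> row_len W i = row_len V i + count_list ss i"
  using assms
proof (induction xs arbitrary: V W ss)
  case (Cons x xs)
  obtain V' s where V': "ins_rows x V = (V', s)" by fastforce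
  obtain W' ss' where W': "ins_word xs V' = (W', ss')" by fastforce
  show ?case
    using row_len_ins_rows[OF V', of i] Cons.IH[OF W'] Cons.prems V' W' by auto
qed auto

lemma ins_rows_max:
  assumes "\<forall>R\<in>set V. \<forall>y\<in>set R. y \<le> k"
  shows "ins_rows k V = (add_cell 0 k V, 0)"
  using assms by (cases V) (auto simp: row_bump_def split: if_splits)

lemma ins_rows_bound:
  assumes "ins_rows y V = (W, r)" and "y \<le> k" and "\<forall>R\<in>set V. \<forall>z\<in>set R. z \<le> k"
  shows "\<forall>R\<in>set W. \<forall>z\<in>set R. z \<le> k"
  using assms
proof (induction V arbitrary: y W r)
  case Nil
  then show ?case by auto
next
  case (Cons Z V)
  obtain Z' o' where b: "row_bump y Z = (Z', o')" by fastforce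
  have "set Z' \<subseteq> insert y (set Z)"
    using b set_subst_first_subset by (cases o') (fastforce simp: row_bump_None row_bump_Some)+
  then have Z': "\<forall>z\<in>set Z'. z \<le> k" using Cons.prems by auto
  show ?case
  proof (cases o')
    case None
    then show ?thesis using Cons.prems b Z' by auto
  next
    case (Some w)
    obtain V2 r2 where V2: "ins_rows w V = (V2, r2)" by fastforce
    have "w \<le> k"
      using b Some Cons.prems(3) Min_greater(1)[of Z y] by (auto simp: row_bump_Some)
    then show ?thesis using Cons.IH[OF V2] Cons.prems b Some V2 Z' by auto
  qed
qed

lemma ins_word_bound:
  assumes "\<forall>x\<in>set xs. x \<le> k" and "\<forall>R\<in>set V. \<forall>z\<in>set R. z \<le> k"
  shows "\<forall>R\<in>set (fst (ins_word xs V)). \<forall>z\<in>set R. z \<le> k"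
  using assms
proof (induction xs arbitrary: V)
  case (Cons x xs)
  obtain V' s where V': "ins_rows x V = (V', s)" by fastforce
  have "\<forall>R\<in>set (fst (ins_word xs V')). \<forall>z\<in>set R. z \<le> k"
    using ins_rows_bound[OF V'] Cons.prems by (intro Cons.IH) auto
  then show ?case using V' by (auto simp: case_prod_beta)
qed auto

text \<open>
  The new \<open>k\<close> plays the role of the rightmost of all letters \<open>k\<close>: it may only be bumped by
  smaller letters, which is why no other \<open>k\<close> may lie in a row below it.
\<close>

lemma ins_rows_add_cell:
  assumes "ins_rows x V = (W, s)" and "x < k" and "\<forall>R\<in>set V. \<forall>y\<in>set R. y \<le> k"
    and "\<forall>R\<in>set (take i V). k \<notin> set R" and "i \<le> length V"
  defines "i' \<equiv> if s = i then Suc i else i"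
  shows "ins_rows x (add_cell i k V) = (add_cell i' k W, if s = i then Suc s else s) \<and>
         (\<forall>R\<in>set W. \<forall>y\<in>set R. y \<le> k) \<and> (\<forall>R\<in>set (take i' W). k \<notin> set R) \<and> i' \<le> length W"
  unfolding i'_def using assms(1-5)
proof (induction V arbitrary: x W s i)
  case Nil
  have "row_bump x [k] = ([x], Some k)"
    using Nil.prems(2) by (auto simp: row_bump_def Let_def Collect_conv_if)
  then show ?case using Nil.prems by auto
next
  case (Cons R V)
  obtain R' o' where b: "row_bump x R = (R', o')" by fastforce
  have sR': "set R' \<subseteq> insert x (set R)"
    using b set_subst_first_subset by (cases o') (fastforce simp: row_bump_None row_bump_Some)+
  show ?case
  proof (cases o')
    case None
    then have R': "\<forall>y\<in>set R. y \<le> x" "R' = R @ [x]" using b by (auto simp: row_bump_None)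
    have W: "W = R' # V" "s = 0" using Cons.prems b None by auto
    show ?thesis
    proof (cases i)
      case 0
      have kR: "k \<notin> set R" using R' Cons.prems(2) by auto
      \<comment> \<open>Without \<open>k\<close> the cell would be created here. Now
        \<open>x\<close> bumps the appended \<open>k\<close>, so that the cell and \<open>k\<close>
        both move one row up.\<close>
      have "{y. (y = k \<or> y \<in> set R) \<and> x < y} = {k}" using R' Cons.prems(2) by auto
      then have "row_bump x (R @ [k]) = (R', Some k)"
        using kR R' Cons.prems(2) by (simp add: row_bump_def Let_def subst_first_append)
      moreover have "ins_rows k V = (add_cell 0 k V, 0)"
        using Cons.prems(3) by (intro ins_rows_max) auto
      ultimately show ?thesis
        using 0 W R' kR Cons.prems by auto
    next
      case (Suc i0)
      then show ?thesis using W R' b None Cons.prems by auto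
    qed
  next
    case (Some y)
    then have ex: "\<exists>y\<in>set R. x < y" and y: "y = Min {y \<in> set R. x < y}"
      and R': "R' = subst_first y x R" using b by (auto simp: row_bump_Some)
    have yR: "y \<in> set R" and xy: "x < y" using Min_greater[OF ex] y by auto
    obtain V' r where V': "ins_rows y V = (V', r)" by fastforce
    have W: "W = R' # V'" "s = Suc r" using Cons.prems b Some V' by auto
    have yk: "y \<le> k" using yR Cons.prems(3) by auto
    have bd: "\<forall>R\<in>set V. \<forall>y\<in>set R. y \<le> k" using Cons.prems(3) by auto
    have entries: "\<forall>R\<in>set V'. \<forall>z\<in>set R. z \<le> k"
      using ins_rows_bound[OF V' yk bd] .
    show ?thesis
    proof (cases i)
      case 0
      \<comment> \<open>The appended \<open>k\<close> is at least \<open>y\<close> and stands to the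
        right of an occurrence of \<open>y\<close> in \<open>R\<close>, so the same leftmost
        \<open>y\<close> is bumped, even when \<open>y = k\<close>.\<close>
      have "{z. (z = k \<or> z \<in> set R) \<and> x < z} = insert k {z \<in> set R. x < z}"
        using Cons.prems(2) by auto
      moreover have "Min (insert k {z \<in> set R. x < z}) = min k (Min {z \<in> set R. x < z})"
        using ex by (intro Min_insert) auto
      ultimately have "Min {z. (z = k \<or> z \<in> set R) \<and> x < z} = y"
        using yk y by (simp only: min_absorb2)
      then have "row_bump x (R @ [k]) = (R' @ [k], Some y)"
        using ex yR R' by (simp add: row_bump_def Let_def subst_first_append)
      then show ?thesis
        using 0 W V' entries sR' Cons.prems by auto
    next
      case (Suc i0)
      have kR: "k \<notin> set R" using Cons.prems(4) Suc by auto
      \<comment> \<open>Since \<open>k\<close> is absent from the rows below it, the letter handed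
        on is again smaller than \<open>k\<close>, as the induction requires.\<close>
      then have "y < k" using yk yR by (metis le_neq_implies_less)
      have "ins_rows y (add_cell i0 k V) = (add_cell (if r = i0 then Suc i0 else i0) k V', if r = i0 then Suc r else r) \<and>
        (\<forall>R\<in>set V'. \<forall>y\<in>set R. y \<le> k) \<and> (\<forall>R\<in>set (take (if r = i0 then Suc i0 else i0) V'). k \<notin> set R)
        \<and> (if r = i0 then Suc i0 else i0) \<le> length V'"
        using Cons.prems Suc bd \<open>y < k\<close> by (intro Cons.IH[OF V']) auto
      then show ?thesis
        using Suc W V' b Some sR' kR Cons.prems(2,3) by (auto split: if_splits)
    qed
  qed
qed

text \<open>
  If insertions create cells in the rows \<open>ss\<close>, in this order, then a largest letter at the end
  of row \<open>i\<close> is moved to row \<open>pass ss i\<close>, and with this letter present the cells are created in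
  the rows \<open>push ss i\<close>.
\<close>

fun pass :: "nat list \<Rightarrow> nat \<Rightarrow> nat" where
  "pass [] i = i"
| "pass (s # ss) i = pass ss (if s = i then Suc i else i)"

fun push :: "nat list \<Rightarrow> nat \<Rightarrow> nat list" where
  "push [] i = []"
| "push (s # ss) i = (if s = i then Suc s # push ss (Suc i) else s # push ss i)"

lemma ins_word_add_cell:
  assumes "ins_word xs V = (W, ss)" and "\<forall>x\<in>set xs. x < k" and "\<forall>R\<in>set V. \<forall>y\<in>set R. y \<le> k"
    and "\<forall>R\<in>set (take i V). k \<notin> set R" and "i \<le> length V"
  shows "ins_word xs (add_cell i k V) = (add_cell (pass ss i) k W, push ss i) \<and>
         (\<forall>R\<in>set W. \<forall>y\<in>set R. y \<le> k) \<and> (\<forall>R\<in>set (take (pass ss i) W). k \<notin> set R) \<and>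
         pass ss i \<le> length W"
  using assms
proof (induction xs arbitrary: V W ss i)
  case (Cons x xs)
  obtain V' s where V': "ins_rows x V = (V', s)" by fastforce
  obtain W' ss' where W': "ins_word xs V' = (W', ss')" by fastforce
  have xk: "x < k" using Cons.prems by auto
  note step = ins_rows_add_cell[OF V' xk Cons.prems(3-5)]
  have eq: "W = W'" "ss = s # ss'" using Cons.prems(1) V' W' by auto
  define i' where "i' = (if s = i then Suc i else i)"
  have IH: "ins_word xs (add_cell i' k V') = (add_cell (pass ss' i') k W', push ss' i') \<and>
         (\<forall>R\<in>set W'. \<forall>y\<in>set R. y \<le> k) \<and> (\<forall>R\<in>set (take (pass ss' i') W'). k \<notin> set R) \<and>
         pass ss' i' \<le> length W'"
    using step Cons.prems(2) unfolding i'_def by (intro Cons.IH[OF W']) auto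
  then show ?case using step eq by (cases "s = i") (auto simp: i'_def)
qed auto

text \<open>At \<open>i = 0\<close> this makes \<open>0 # push ss 0\<close> strictly increasing, the
  list of rows that arises when a new letter joins the last cell of a row.\<close>

lemma push_greater:
  "sorted_wrt (<) ss \<Longrightarrow> \<forall>s\<in>set ss. i \<le> s \<Longrightarrow> \<forall>s\<in>set (push ss i). i < s"
proof (induction ss arbitrary: i)
  case (Cons s ss)
  have "\<forall>t\<in>set (push ss (Suc i)). Suc i < t" if "s = i"
    using Cons.prems that by (intro Cons.IH) auto
  moreover have "\<forall>t\<in>set (push ss i). i < t" if "s \<noteq> i"
    using Cons.prems that by (intro Cons.IH) auto
  ultimately show ?case using Cons.prems by (auto dest: Suc_lessD)
qed auto

lemma push_mono: "\<forall>s\<in>set ss. m < s \<Longrightarrow> \<forall>s\<in>set (push ss i). m < s"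
  by (induction ss arbitrary: i) auto

lemma sorted_push: "sorted_wrt (<) ss \<Longrightarrow> sorted_wrt (<) (push ss i)"
proof (induction ss arbitrary: i)
  case (Cons s ss)
  then show ?case
    using push_greater[of ss "Suc i"] push_mono[of ss s i] by (auto simp: Suc_le_eq)
qed auto

text \<open>Because \<open>ss\<close> increases, a cell in row \<open>i + 1\<close> is created only
  after the one in row \<open>i\<close>. The letter is therefore lifted through consecutive members
  of \<open>ss\<close> and stops at the first gap.\<close>

lemma pass_least:
  assumes "sorted_wrt (<) ss"
  shows "i \<le> pass ss i \<and> pass ss i \<notin> set ss \<and> (\<forall>i'. i \<le> i' \<and> i' < pass ss i \<longrightarrow> i' \<in> set ss)"
  using assms
proof (induction ss arbitrary: i)
  case (Cons s ss)
  have IH: "j \<le> pass ss j \<and> pass ss j \<notin> set ss \<and> (\<forall>i'. j \<le> i' \<and> i' < pass ss j \<longrightarrow> i' \<in> set ss)" for j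
    using Cons by auto
  show ?case
  proof (cases "s = i")
    case True
    then show ?thesis using IH[of "Suc i"] by (auto simp: Suc_le_eq) (metis le_neq_implies_less)
  next
    case False
    have "pass ss i \<noteq> s"
    proof
      assume p: "pass ss i = s"
      then have "i < s" using IH[of i] False by auto
      then have "i \<in> set ss" using IH[of i] p by auto
      then show False using Cons.prems \<open>i < s\<close> by auto
    qed
    then show ?thesis using IH[of i] False by auto
  qed
qed auto

subsection \<open>Star insertion into a tableau of blocks\<close>

text \<open>
  \<open>b r\<close> is the length of the row in question in the uncrowding of the rows from \<open>r\<close> upwards.
  Block \<open>r\<close> consists of the columns \<open>b (Suc r) \<le> j < b r\<close>, where the entry is \<open>l - r + j\<close>.
\<close>

definition block_val :: "nat \<Rightarrow> (nat \<Rightarrow> nat) \<Rightarrow> nat \<Rightarrow> nat" where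
  "block_val l b j = l + j - card {r \<in> {1..<l}. j < b r}"

definition block_row :: "nat \<Rightarrow> (nat \<Rightarrow> nat) \<Rightarrow> nat list" where
  "block_row l b = map (block_val l b) [0..<b 0]"

text \<open>For a column of block \<open>r\<close> the indices counted in \<open>block_val\<close>
  are exactly \<open>1, ..., r\<close>.\<close>

lemma block_val_eq:
  assumes "antimono b" and "b (Suc r) \<le> j" and "j < b r" and "r < l"
  shows "block_val l b j = l - r + j"
proof -
  have "{s \<in> {1..<l}. j < b s} = {1..<Suc r}"
  proof (intro equalityI subsetI)
    fix s assume s: "s \<in> {s \<in> {1..<l}. j < b s}"
    have "s < Suc r"
    proof (rule ccontr)
      assume "\<not> s < Suc r"
      then have "b s \<le> b (Suc r)" using antimonoD[OF assms(1), of "Suc r" s] by auto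
      then show False using s assms(2) by auto
    qed
    then show "s \<in> {1..<Suc r}" using s by auto
  next
    fix s assume s: "s \<in> {1..<Suc r}"
    then have "b r \<le> b s" using antimonoD[OF assms(1), of s r] by auto
    then show "s \<in> {s \<in> {1..<l}. j < b s}" using s assms by auto
  qed
  then show ?thesis using assms(4) unfolding block_val_def by simp
qed

text \<open>The subtracted count weakly decreases with the column, so values grow at least as fast
  as columns.\<close>

lemma block_val_drop:
  assumes "i \<le> j"
  shows "block_val l b i + (j - i) \<le> block_val l b j"
proof -
  have "card {r \<in> {1..<l}. j < b r} \<le> card {r \<in> {1..<l}. i < b r}"
    using assms by (intro card_mono) auto
  moreover have "card {r \<in> {1..<l}. i < b r} \<le> card {1..<l}" by (intro card_mono) auto
  ultimately show ?thesis using assms unfolding block_val_def by auto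
qed

lemma block_val_less: "i < j \<Longrightarrow> block_val l b i < block_val l b j"
  using block_val_drop[of i j l b] by linarith

lemma block_val_inj: "block_val l b i = block_val l b j \<longleftrightarrow> i = j"
  using block_val_less[of i j l b] block_val_less[of j i l b] by (cases i j rule: linorder_cases) auto

lemma block_val_le_iff: "block_val l b i \<le> block_val l b j \<longleftrightarrow> i \<le> j"
  using block_val_less[of i j l b] block_val_less[of j i l b] by (cases i j rule: linorder_cases) auto

text \<open>Crossing the end of block \<open>r\<close> removes \<open>r\<close> from the subtracted
  count, so at least one value is skipped. These gaps separate case 2 from case 3 of the
  insertion.\<close>

lemma block_val_gap:
  assumes "antimono b" and "j < b r" and "b r \<le> i" and "0 < r" and "r < l"
  shows "Suc (block_val l b j) < block_val l b i"
proof -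
  have "{s \<in> {1..<l}. i < b s} \<subset> {s \<in> {1..<l}. j < b s}"
  proof
    show "{s \<in> {1..<l}. i < b s} \<subseteq> {s \<in> {1..<l}. j < b s}" using assms by auto
    have "r \<in> {s \<in> {1..<l}. j < b s}" "r \<notin> {s \<in> {1..<l}. i < b s}" using assms by auto
    then show "{s \<in> {1..<l}. i < b s} \<noteq> {s \<in> {1..<l}. j < b s}" by blast
  qed
  then have "card {s \<in> {1..<l}. i < b s} < card {s \<in> {1..<l}. j < b s}"
    by (intro psubset_card_mono) auto
  moreover have "card {s \<in> {1..<l}. j < b s} \<le> card {1..<l}" by (intro card_mono) auto
  ultimately show ?thesis using assms unfolding block_val_def by auto
qed

section \<open>The three cases of star insertion into a row of blocks\<close>

lemma set_block_row: "set (block_row l b) = block_val l b ` {..<b 0}"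
  unfolding block_row_def by auto

text \<open>Case 1: the value in column \<open>j\<close> is at most \<open>l + j\<close>, and the
  inserted letter continues block 0.\<close>

lemma star_row_append:
  assumes "antimono b"
  shows "star_row (l + b 0) (block_row l b) = (block_row l (b(0 := Suc (b 0))), None)"
proof -
  have "x < l + b 0" if "x \<in> set (block_row l b)" for x
    using that unfolding set_block_row block_val_def by auto
  then have "block_row l b = [] \<or> Max (set (block_row l b)) < l + b 0"
    by (cases "block_row l b = []") auto
  moreover have "block_val l (b(0 := Suc (b 0))) = block_val l b"
    unfolding block_val_def by (intro ext arg_cong2[where f = "(-)"] arg_cong[where f = card]) auto
  moreover have "block_val l b (b 0) = l + b 0"
  proof -
    have "{r \<in> {1..<l}. b 0 < b r} = {}"
      using antimonoD[OF assms, of 0] by (auto simp: not_less)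
    then show ?thesis unfolding block_val_def by (simp only: card.empty minus_nat.diff_0)
  qed
  ultimately show ?thesis unfolding star_row_def block_row_def by auto
qed

text \<open>Case 2: column \<open>b r\<close> is the first one of block \<open>r - 1\<close> and
  holds the successor of the inserted letter, which itself falls into the gap before that block.
  Bumping this successor moves the column from block \<open>r - 1\<close> to block
  \<open>r\<close>.\<close>

lemma star_row_shift:
  assumes b: "antimono b" and r: "0 < r" "r < l" "b r < b (r - 1)"
  shows "star_row (l - r + b r) (block_row l b) =
         (block_row l (b(r := Suc (b r))), Some (Suc (l - r + b r)))"
proof -
  let ?R = "block_row l b" and ?x = "l - r + b r"
  have val: "block_val l b (b r) = Suc ?x"
    using block_val_eq[OF b, of "r - 1" "b r" l] r by auto
  have len: "b r < b 0" using r antimonoD[OF b, of 0 "r - 1"] by auto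
  have lt: "block_val l b j \<noteq> ?x" for j
    using block_val_gap[OF b, of j r "b r" l] block_val_le_iff[of l b "b r" j] r val
    by (cases "j < b r") auto
  have notin: "?x \<notin> set ?R" using lt unfolding set_block_row by (metis imageE)
  have ne: "?R \<noteq> []" using len unfolding block_row_def by auto
  have "Suc ?x \<in> set ?R" using val len unfolding set_block_row by (metis image_eqI lessThan_iff)
  then have nmax: "\<not> ?x > Max (set ?R)"
    by (meson List.finite_set Max_ge Suc_n_not_le_n less_imp_le order_trans)
  have "Min {y \<in> set ?R. ?x < y} = Suc ?x"
    using \<open>Suc ?x \<in> set ?R\<close> by (intro Min_eqI) auto
  moreover have "map (\<lambda>z. if z = Suc ?x then ?x else z) ?R = block_row l (b(r := Suc (b r)))"
  proof -
    have "(if block_val l b j = Suc ?x then ?x else block_val l b j) =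
          block_val l (b(r := Suc (b r))) j" for j
    proof (cases "j = b r")
      case True
      have b': "antimono (b(r := Suc (b r)))"
      proof (rule antimonoI)
        fix s t :: nat assume st: "s \<le> t"
        have "t = r \<Longrightarrow> s < r \<Longrightarrow> Suc (b r) \<le> b s"
          using antimonoD[OF b, of s "r - 1"] r by (simp add: less_eq_Suc_le[symmetric] order.strict_trans2)
        then show "(b(r := Suc (b r))) t \<le> (b(r := Suc (b r))) s"
          using antimonoD[OF b st] st by (auto simp: le_Suc_eq)
      qed
      have "block_val l (b(r := Suc (b r))) (b r) = l - r + b r"
        using r antimonoD[OF b, of r "Suc r"] by (intro block_val_eq[OF b']) auto
      then show ?thesis using True val by simp
    next
      case False
      then have "{s \<in> {1..<l}. j < b s} = {s \<in> {1..<l}. j < (b(r := Suc (b r))) s}" by auto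
      then have "block_val l (b(r := Suc (b r))) j = block_val l b j"
        unfolding block_val_def by simp
      then show ?thesis using False val block_val_inj by metis
    qed
    then show ?thesis using r unfolding block_row_def by simp
  qed
  ultimately show ?thesis using ne nmax notin unfolding star_row_def by (simp add: Let_def)
qed

text \<open>Case 3: the inserted letter is the last one of block \<open>r\<close>. By
  \<open>block_val_gap\<close> the run of consecutive letters ending there does not reach below the
  block, so the first letter of the block is passed on.\<close>

lemma star_row_keep:
  assumes b: "antimono b" and r: "r < l" "b (Suc r) < b r" and l: "\<forall>r\<ge>l. b r = 0"
  shows "star_row (l - r + (b r - 1)) (block_row l b) = (block_row l b, Some (l - r + b (Suc r)))"
proof -
  let ?R = "block_row l b" and ?x = "l - r + (b r - 1)" and ?y = "l - r + b (Suc r)"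
  have len: "b r \<le> b 0" using antimonoD[OF b, of 0 r] by auto
  have val: "block_val l b j = l - r + j" if "b (Suc r) \<le> j" "j < b r" for j
    using block_val_eq[OF b that r(1)] .
  have run: "{?y..?x} \<subseteq> set ?R"
  proof
    fix z assume z: "z \<in> {?y..?x}"
    then have "b (Suc r) \<le> z - (l - r)" "z - (l - r) < b r" "l - r \<le> z" using r by auto
    then show "z \<in> set ?R" using val[of "z - (l - r)"] len unfolding set_block_row
      by (intro image_eqI[of _ _ "z - (l - r)"]) auto
  qed
  then have xin: "?x \<in> set ?R" and yin: "?y \<in> set ?R" using r by auto
  have "?y - 1 \<notin> set ?R"
  proof
    assume "?y - 1 \<in> set ?R"
    then obtain j where j: "j < b 0" "block_val l b j = ?y - 1" unfolding set_block_row by auto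
    have vy: "block_val l b (b (Suc r)) = ?y" using val r by auto
    then have jl: "j < b (Suc r)" using j block_val_le_iff[of l b "b (Suc r)" j] r by auto
    then have "Suc r < l" using l by (metis not_less less_nat_zero_code)
    then have "Suc (block_val l b j) < ?y"
      using block_val_gap[OF b jl, of "b (Suc r)" l] vy by auto
    then show False using j by auto
  qed
  then have low: "?y \<le> y" if "y \<le> ?x" "{y..?x} \<subseteq> set ?R" for y
  proof (rule_tac ccontr)
    assume "\<not> ?y \<le> y"
    then have "?y - 1 \<in> {y..?x}" using r by auto
    then show False using that \<open>?y - 1 \<notin> set ?R\<close> by auto
  qed
  have "Min {y \<in> set ?R. y \<le> ?x \<and> {y..?x} \<subseteq> set ?R} = ?y"
  proof (intro Min_eqI)
    show "?y \<in> {y \<in> set ?R. y \<le> ?x \<and> {y..?x} \<subseteq> set ?R}"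
      using yin run r(2) by (intro CollectI conjI) auto
  qed (use low in simp_all)
  moreover have "?x \<le> Max (set ?R)" using xin by (intro Max_ge) auto
  moreover have "?R \<noteq> []" using xin by force
  ultimately show ?thesis using xin unfolding star_row_def
    by (simp only: not_less[symmetric] if_False simp_thms)
qed

section \<open>Bumping paths of star insertion through all rows\<close>

definition block_rows :: "nat \<Rightarrow> (nat \<Rightarrow> nat \<Rightarrow> nat) \<Rightarrow> nat \<Rightarrow> nat \<Rightarrow> nat list list" where
  "block_rows l a i N = map (\<lambda>i. block_row l (\<lambda>r. a r i)) [i..<N]"

lemma block_rows_Cons:
  "i < N \<Longrightarrow> block_rows l a i N = block_row l (\<lambda>r. a r i) # block_rows l a (Suc i) N"
  unfolding block_rows_def by (simp add: upt_conv_Cons)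

text \<open>The last condition says that \<open>a r\<close> without its bottom row contains
  \<open>a (Suc r)\<close> and that the difference is a vertical strip.\<close>

definition shape_chain :: "nat \<Rightarrow> (nat \<Rightarrow> nat \<Rightarrow> nat) \<Rightarrow> bool" where
  "shape_chain l a \<longleftrightarrow> (\<forall>r i. a r (Suc i) \<le> a r i) \<and> (\<forall>r\<ge>l. \<forall>i. a r i = 0) \<and>
     (\<forall>r i. a (Suc r) i \<le> a r (Suc i) \<and> a r (Suc i) \<le> Suc (a (Suc r) i))"

text \<open>
  If a letter larger than all others is appended to row \<open>i\<close> of the uncrowding of the rows above
  \<open>r\<close>, then it ends up in row \<open>j\<close> once the extra letters of row \<open>r\<close> have been inserted.
\<close>

definition next_row :: "(nat \<Rightarrow> nat \<Rightarrow> nat) \<Rightarrow> nat \<Rightarrow> nat \<Rightarrow> nat \<Rightarrow> bool" where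
  "next_row a r i j \<longleftrightarrow> i < j \<and> a r j = a (Suc r) (j - 1) \<and>
     (\<forall>j'. i < j' \<and> j' < j \<longrightarrow> a r j' = Suc (a (Suc r) (j' - 1)))"

definition add_path :: "(nat \<Rightarrow> nat \<Rightarrow> nat) \<Rightarrow> (nat \<Rightarrow> nat) \<Rightarrow> nat \<Rightarrow> nat \<Rightarrow> nat \<Rightarrow> nat" where
  "add_path a J n r i = a r i + (if r < n \<and> i = J r then 1 else 0)"

lemma shape_chain_antimono:
  assumes "shape_chain l a"
  shows "antimono (\<lambda>r. a r i)"
proof -
  have "a (Suc r) i \<le> a r i" for r
    using assms unfolding shape_chain_def by (meson order_trans)
  then show ?thesis by (simp add: antimono_iff_le_Suc)
qed

lemma block_rows_cong:
  "(\<And>r i. i0 \<le> i \<Longrightarrow> a r i = a' r i) \<Longrightarrow> block_rows l a i0 N = block_rows l a' i0 N"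
  unfolding block_rows_def by (intro map_cong) auto

lemma path_mono:
  fixes J :: "nat \<Rightarrow> nat"
  assumes "\<forall>r<n. J (Suc r) < J r" and "r \<le> n"
  shows "J n \<le> J r"
  using assms(2)
proof (induction rule: inc_induct)
  case (step m)
  then have "J (Suc m) < J m" using assms(1) by blast
  then show ?case using step by linarith
qed simp

text \<open>
  The content \<open>l - r + a (Suc r) i\<close> is the first value of block \<open>r\<close> in row \<open>i\<close>, which has just
  been bumped out of that row.
\<close>

lemma star_rows_climb:
  assumes a: "shape_chain l a" and "a (Suc r) i < a r i" and "r < l"
    and "next_row a r i (J r)" and "\<forall>s<r. next_row a s (J (Suc s)) (J s)"
    and N: "\<forall>i\<ge>N. a 0 i = 0"
  shows "star_rows (l - r + a (Suc r) i) (block_rows l a (Suc i) N) =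
     (block_rows l (add_path a J (Suc r)) (Suc i) (max N (Suc (J 0))), J 0 - Suc i)"
  \<comment> \<open>The measure is the height still to climb; \<open>r\<close> varies because it
    drops by one at each row in which a block grows.\<close>
  using assms(2-5)
proof (induction "N - i" arbitrary: i r rule: less_induct)
  case less
  let ?b = "\<lambda>s. a s (Suc i)"
  have b: "antimono ?b" using shape_chain_antimono[OF a] .
  have anti: "a s (Suc i) \<le> a s i" "a (Suc s) i \<le> a s (Suc i)" "a s (Suc i) \<le> Suc (a (Suc s) i)"
    for s i using a unfolding shape_chain_def by auto
  have zero: "a s i = 0" if "l \<le> s" for s i using a that unfolding shape_chain_def by auto
  have le0: "a s i \<le> a 0 i" for s i using antimonoD[OF shape_chain_antimono[OF a], of 0 s] by auto
  have iN: "i < N" using less.prems(1) N le0[of r i] by (metis not_less le_zero_eq less_nat_zero_code)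
  have Jlt: "J (Suc s) < J s" if "s < r" for s using less.prems(4) that unfolding next_row_def by auto
  have Jle: "J s \<le> J t" if "t \<le> s" "s \<le> r" for s t
    using path_mono[of s J t] Jlt that by auto
  \<comment> \<open>From \<open>a (Suc r) i < a r i <= a (r - 1) (Suc i)\<close>: block
    \<open>r - 1\<close> of the next row is nonempty, so its first letter can be bumped and the
    climb can continue from it.\<close>
  have up: "a r (Suc i) < a (r - 1) (Suc i)" if "0 < r" "a r (Suc i) = a (Suc r) i"
    using anti(2)[of "r - 1" i] that less.prems(1) by auto
  have next_eq: "J r = Suc i" if "a r (Suc i) = a (Suc r) i"
  proof (rule ccontr)
    assume "J r \<noteq> Suc i"
    then have "i < Suc i \<and> Suc i < J r" using less.prems(3) unfolding next_row_def by auto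
    then have "a r (Suc i) = Suc (a (Suc r) (Suc i - 1))"
      using less.prems(3) unfolding next_row_def by blast
    then show False using that by simp
  qed
  show ?case
  proof (cases "Suc i < N")
    case False
    \<comment> \<open>No row is left here, and all shapes vanish in row \<open>Suc i\<close>. This
      forces \<open>r = 0\<close>, and the letter, which is \<open>l\<close>, starts a new
      row.\<close>
    then have N': "N = Suc i" using iN by auto
    have "a s (Suc i) = 0" for s using N le0[of s "Suc i"] N' by auto
    then have "r = 0" and eq: "a r (Suc i) = a (Suc r) i"
      using up anti(2)[of r i] by auto
    have J: "J 0 = Suc i"
      using next_eq[OF eq] \<open>r = 0\<close> by simp
    have "block_row l (\<lambda>s. add_path a J (Suc 0) s (Suc i)) = block_row l ((?b)(0 := Suc (a 0 (Suc i))))"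
      by (intro arg_cong[where f = "block_row l"] ext) (auto simp: add_path_def J)
    moreover have "star_row (l + a 0 (Suc i)) (block_row l ?b) = (block_row l (?b(0 := Suc (a 0 (Suc i)))), None)"
      using star_row_append[OF b, of l] by simp
    moreover have "block_row l ?b = []" using \<open>\<And>s. a s (Suc i) = 0\<close> by (simp add: block_row_def)
    ultimately have "block_row l (\<lambda>s. add_path a J (Suc 0) s (Suc i)) = [l + a 0 (Suc i)]"
      by (simp add: star_row_def)
    then show ?thesis using J N' eq \<open>r = 0\<close> by (auto simp: block_rows_def)
  next
    case True
    show ?thesis
    proof (cases "a r (Suc i) = a (Suc r) i")
      case eq: True
      \<comment> \<open>The letter is the one that extends block \<open>r\<close> in this row: it is
        appended if \<open>r = 0\<close> and otherwise bumps the first letter of block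
        \<open>r - 1\<close>.\<close>
      have J: "J r = Suc i"
        using next_eq[OF eq] .
      have row: "(\<lambda>s. add_path a J (Suc r) s (Suc i)) = (?b)(r := Suc (a r (Suc i)))"
      proof
        fix s
        have "J s \<noteq> Suc i" if "s < r" using Jlt[OF that] Jle[of "Suc s" r] J that by auto
        then show "add_path a J (Suc r) s (Suc i) = ((?b)(r := Suc (a r (Suc i)))) s"
          using J by (auto simp: add_path_def less_Suc_eq)
      qed
      show ?thesis
      proof (cases r)
        case 0
        have "block_rows l a (Suc (Suc i)) N = block_rows l (add_path a J (Suc r)) (Suc (Suc i)) N"
          using J 0 by (intro block_rows_cong) (auto simp: add_path_def)
        then show ?thesis
          using star_row_append[OF b, of l] True J 0 eq row
          by (simp add: block_rows_Cons max_absorb1 Suc_le_eq)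
      next
        case (Suc r')
        have J': "J r' > Suc i" using Jlt[of r'] J Suc by auto
        have J0: "Suc i < J 0" using Jle[of 0 r'] J' Suc by auto
        have nx: "next_row a r' (Suc i) (J r')" using less.prems(4) J Suc by auto
        have IH: "star_rows (l - r' + a (Suc r') (Suc i)) (block_rows l a (Suc (Suc i)) N) =
          (block_rows l (add_path a J (Suc r')) (Suc (Suc i)) (max N (Suc (J 0))), J 0 - Suc (Suc i))"
          using less.hyps[of "Suc i" r'] iN nx less.prems up eq Suc by auto
        have cong: "block_rows l (add_path a J (Suc r')) (Suc (Suc i)) M =
                    block_rows l (add_path a J (Suc r)) (Suc (Suc i)) M" for M
          using J Suc by (intro block_rows_cong) (auto simp: add_path_def less_Suc_eq)
        have "star_row (l - r + a (Suc r) i) (block_row l ?b) =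
          (block_row l (?b(r := Suc (a r (Suc i)))), Some (Suc (l - r + a r (Suc i))))"
          using star_row_shift[OF b, of r l] up eq Suc less.prems by auto
        \<comment> \<open>The bumped letter has the form required by the induction hypothesis for
          \<open>r'\<close>.\<close>
        moreover have "Suc (l - r + a r (Suc i)) = l - r' + a (Suc r') (Suc i)"
          using Suc less.prems by auto
        ultimately show ?thesis
          using IH True J0 row cong by (simp add: block_rows_Cons Suc_diff_Suc)
      qed
    next
      case ne: False
      \<comment> \<open>The letter is now the last one of block \<open>r\<close> in row
        \<open>Suc i\<close>, so the row stays unchanged and the first letter of the block climbs
        on.\<close>
      then have eq: "a r (Suc i) = Suc (a (Suc r) i)" using anti(2,3)[of r i] by auto
      have lt: "a (Suc r) (Suc i) < a r (Suc i)" using anti(1)[of "Suc r" i] eq by auto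
      have Jr: "Suc i < J r" using less.prems(3) ne unfolding next_row_def
        by (cases "J r = Suc i") auto
      then have nx: "next_row a r (Suc i) (J r)"
        using less.prems(3) unfolding next_row_def by auto
      have J0: "Suc i < J 0" using Jle[of 0 r] Jr by auto
      have IH: "star_rows (l - r + a (Suc r) (Suc i)) (block_rows l a (Suc (Suc i)) N) =
          (block_rows l (add_path a J (Suc r)) (Suc (Suc i)) (max N (Suc (J 0))), J 0 - Suc (Suc i))"
        using less.hyps[of "Suc i" r] iN nx less.prems lt by auto
      have row: "(\<lambda>s. add_path a J (Suc r) s (Suc i)) = ?b"
      proof
        fix s
        have "J s \<noteq> Suc i" if "s \<le> r" using Jle[of s r] Jr that by auto
        then show "add_path a J (Suc r) s (Suc i) = a s (Suc i)"
          by (auto simp: add_path_def)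
      qed
      have "star_row (l - r + a (Suc r) i) (block_row l ?b) =
          (block_row l ?b, Some (l - r + a (Suc r) (Suc i)))"
        using star_row_keep[OF b, of r l] lt eq less.prems zero by auto
      then show ?thesis
        using IH True J0 row by (simp add: block_rows_Cons Suc_diff_Suc)
    qed
  qed
qed

text \<open>The inserted letter is the content of the cell just after the end of row
  \<open>r\<close>. It extends block \<open>r\<close> of the bottom row; for positive
  \<open>r\<close> the strict inequality provides the letter of block \<open>r - 1\<close> that
  starts the climb.\<close>

lemma star_rows_new_cell:
  assumes a: "shape_chain l a" and r: "r < l" "0 < r \<longrightarrow> a r 0 < a (r - 1) 0"
    and J: "J r = 0" "\<forall>s<r. next_row a s (J (Suc s)) (J s)"
    and N: "\<forall>i\<ge>N. a 0 i = 0" "0 < N"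
  shows "star_rows (l - r + a r 0) (block_rows l a 0 N) =
     (block_rows l (add_path a J (Suc r)) 0 (max N (Suc (J 0))), J 0)"
proof -
  let ?b = "\<lambda>s. a s 0"
  have b: "antimono ?b" using shape_chain_antimono[OF a] .
  have Jpos: "0 < J s" if "s < r" for s
    using J(2) that unfolding next_row_def by (metis gr_zeroI not_less_zero)
  have row: "(\<lambda>s. add_path a J (Suc r) s 0) = ?b(r := Suc (a r 0))"
  proof
    fix s
    show "add_path a J (Suc r) s 0 = (?b(r := Suc (a r 0))) s"
      using Jpos[of s] J by (auto simp: add_path_def less_Suc_eq)
  qed
  show ?thesis
  proof (cases r)
    case 0
    have "block_rows l a (Suc 0) N = block_rows l (add_path a J (Suc r)) (Suc 0) N"
      using J 0 by (intro block_rows_cong) (auto simp: add_path_def)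
    then show ?thesis
      using star_row_append[OF b, of l] J 0 row N(2) by (simp add: block_rows_Cons max_absorb1 Suc_le_eq)
  next
    case (Suc r')
    have nx: "next_row a r' 0 (J r')" using J Suc by auto
    have IH: "star_rows (l - r' + a (Suc r') 0) (block_rows l a (Suc 0) N) =
      (block_rows l (add_path a J (Suc r')) (Suc 0) (max N (Suc (J 0))), J 0 - Suc 0)"
      using star_rows_climb[where r = r' and i = 0 and J = J, OF a _ _ nx _ N(1)] r J Suc by auto
    have cong: "block_rows l (add_path a J (Suc r')) (Suc 0) M =
                block_rows l (add_path a J (Suc r)) (Suc 0) M" for M
      using J Suc by (intro block_rows_cong) (auto simp: add_path_def less_Suc_eq)
    have "star_row (l - r + a r 0) (block_row l ?b) =
      (block_row l (?b(r := Suc (a r 0))), Some (Suc (l - r + a r 0)))"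
      using star_row_shift[OF b, of r l] r Suc by auto
    moreover have "Suc (l - r + a r 0) = l - r' + a (Suc r') 0"
      using Suc r by auto
    with IH have "star_rows (Suc (l - r + a r 0)) (block_rows l a (Suc 0) N) =
      (block_rows l (add_path a J (Suc r)) (Suc 0) (max N (Suc (J 0))), J 0 - Suc 0)"
      by (simp only: cong)
    moreover have "0 < J 0" using Jpos[of 0] Suc by auto
    ultimately show ?thesis
      using N(2) row by (simp add: block_rows_Cons[of 0])
  qed
qed

text \<open>The inserted letter is the content of the last cell of row \<open>r\<close>, hence the
  last letter of block \<open>r\<close> in the bottom row, and case 3 applies at once.\<close>

lemma star_rows_extra:
  assumes a: "shape_chain l a" and r: "r < l" "a (Suc r) 0 < a r 0"
    and J: "next_row a r 0 (J r)" "\<forall>s<r. next_row a s (J (Suc s)) (J s)"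
    and N: "\<forall>i\<ge>N. a 0 i = 0" "0 < N"
  shows "star_rows (l - r + (a r 0 - 1)) (block_rows l a 0 N) =
     (block_rows l (add_path a J (Suc r)) 0 (max N (Suc (J 0))), J 0)"
proof -
  let ?b = "\<lambda>s. a s 0"
  have b: "antimono ?b" using shape_chain_antimono[OF a] .
  have Jpos: "0 < J s" if "s \<le> r" for s
    using J that unfolding next_row_def by (metis gr_zeroI le_neq_implies_less not_less_zero)
  have row: "(\<lambda>s. add_path a J (Suc r) s 0) = ?b"
  proof
    fix s
    show "add_path a J (Suc r) s 0 = a s 0"
      using Jpos[of s] by (auto simp: add_path_def)
  qed
  have "star_row (l - r + (a r 0 - 1)) (block_row l ?b) =
        (block_row l ?b, Some (l - r + a (Suc r) 0))"
    using star_row_keep[OF b, of r l] r a unfolding shape_chain_def by auto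
  moreover have "star_rows (l - r + a (Suc r) 0) (block_rows l a (Suc 0) N) =
      (block_rows l (add_path a J (Suc r)) (Suc 0) (max N (Suc (J 0))), J 0 - Suc 0)"
    using star_rows_climb[OF a r(2,1) J N(1)] by simp
  ultimately show ?thesis using N(2) row Jpos[of 0] by (simp add: block_rows_Cons)
qed

subsection \<open>Adding one entry\<close>

text \<open>The order is the one in which uncrowding removes these letters: cells from right to
  left, and each cell from its largest letter down.\<close>

definition extras :: "nat set list \<Rightarrow> nat list" where
  "extras R = concat (map (\<lambda>A. rev (sorted_list_of_set (A - {Min A}))) (rev R))"

text \<open>Uncrowding as a recursion on rows instead of a loop;
  \<open>uncrowd_P_eq_uncrowded\<close> identifies the two.\<close>

fun uncrowded :: "nat set list list \<Rightarrow> nat list list" where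
  "uncrowded [] = []"
| "uncrowded (R # S) = map Min R # fst (ins_word (extras R) (uncrowded S))"

text \<open>
  \<open>chain S r\<close> is the shape of the uncrowding of the rows from \<open>r\<close> upwards, with row \<open>r\<close> as
  row 0. \<open>new_rows S r\<close> lists the rows, counted from row \<open>r + 1\<close>, in which the successive
  extra letters of row \<open>r\<close> create their cells.
\<close>

definition chain :: "nat set list list \<Rightarrow> nat \<Rightarrow> nat \<Rightarrow> nat" where
  "chain S r i = row_len (uncrowded (drop r S)) i"

definition new_rows :: "nat set list list \<Rightarrow> nat \<Rightarrow> nat list" where
  "new_rows S r = snd (ins_word (extras (S ! r)) (uncrowded (drop (Suc r) S)))"

definition cells_bounded :: "nat \<Rightarrow> nat set list list \<Rightarrow> bool" where
  "cells_bounded k S \<longleftrightarrow> (\<forall>R\<in>set S. \<forall>A\<in>set R. A \<noteq> {} \<and> A \<subseteq> {..k})"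

lemma extras_subset: "\<forall>A\<in>set R. finite A \<Longrightarrow> set (extras R) \<subseteq> \<Union>(set R)"
  unfolding extras_def by auto

lemma extras_append_singleton: "extras (R @ [{k}]) = extras R"
  unfolding extras_def by simp

text \<open>The last cell is read first and its largest letter comes first, so \<open>k\<close>
  heads the list; the minimum of the cell is unaffected.\<close>

lemma extras_insert_max:
  assumes "finite A" "A \<noteq> {}" "\<forall>a\<in>A. a < k"
  shows "extras (R @ [insert k A]) = k # extras (R @ [A])" "Min (insert k A) = Min A"
proof -
  have "Min A < k" using assms by simp
  then show M: "Min (insert k A) = Min A" using assms by simp
  have "k \<notin> A" using assms by auto
  then have eq: "insert k A - {Min A} = insert k (A - {Min A})" using \<open>Min A < k\<close> by auto
  have "sorted_list_of_set (insert k (A - {Min A})) = sorted_list_of_set (A - {Min A}) @ [k]"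
    using assms \<open>k \<notin> A\<close> sorted_insort_is_snoc[of "sorted_list_of_set (A - {Min A})" k]
    by (simp add: less_imp_le)
  then show "extras (R @ [insert k A]) = k # extras (R @ [A])"
    unfolding extras_def using M eq by simp
qed

lemma uncrowded_bounded:
  assumes "cells_bounded k S"
  shows "\<forall>R\<in>set (uncrowded S). \<forall>z\<in>set R. z \<le> k"
  using assms
proof (induction S)
  case (Cons R S)
  have fin: "\<forall>A\<in>set R. finite A" using Cons.prems unfolding cells_bounded_def
    by (metis finite_atMost finite_subset list.set_intros(1))
  then have "\<forall>A\<in>set R. Min A \<le> k"
    using Cons.prems unfolding cells_bounded_def by (metis Min_in atMost_iff list.set_intros(1) subsetD)
  moreover have "\<forall>x\<in>set (extras R). x \<le> k"
    using extras_subset[OF fin] Cons.prems unfolding cells_bounded_def by fastforce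
  ultimately show ?case
    using ins_word_bound[of "extras R" k "uncrowded S"] Cons unfolding cells_bounded_def by auto
qed auto

lemma cells_bounded_drop: "cells_bounded k S \<Longrightarrow> cells_bounded k (drop r S)"
  unfolding cells_bounded_def by (meson in_set_dropD)

lemma length_uncrowded: "length S \<le> length (uncrowded S)"
proof (induction S)
  case (Cons R S)
  have "length (uncrowded S) \<le> length (fst (ins_word (extras R) (uncrowded S)))"
    using row_len_ins_word[of "extras R" "uncrowded S"] by (metis prod.collapse)
  then show ?case using Cons by simp
qed simp

section \<open>Shapes of the partial uncrowdings\<close>

lemma chain_0: "r < length S \<Longrightarrow> chain S r 0 = length (S ! r)"
  unfolding chain_def by (simp add: Cons_nth_drop_Suc[symmetric])

lemma chain_Suc:
  "r < length S \<Longrightarrow> chain S r (Suc i) = chain S (Suc r) i + count_list (new_rows S r) i"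
  using row_len_ins_word[of "extras (S ! r)" "uncrowded (drop (Suc r) S)" _ _ i]
  unfolding chain_def new_rows_def
  by (simp add: Cons_nth_drop_Suc[symmetric])

lemma chain_out: "length S \<le> r \<Longrightarrow> chain S r i = 0"
  unfolding chain_def by simp

text \<open>The invariant of the construction. Strictly increasing creation rows mean at most one
  new cell per row, which yields the vertical strips of \<open>shape_chain\<close>.\<close>

definition regular :: "nat set list list \<Rightarrow> bool" where
  "regular S \<longleftrightarrow> (\<forall>r<length S. sorted_wrt (<) (new_rows S r)) \<and>
     (\<forall>r i. chain S r (Suc i) \<le> chain S r i)"

lemma count_list_sorted: "sorted_wrt (<) ss \<Longrightarrow> count_list ss i = (if i \<in> set (ss :: nat list) then 1 else 0)"
  by (induction ss) auto

lemma regular_shape_chain: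
  assumes "regular S"
  shows "shape_chain (length S) (chain S)"
proof -
  have "chain S (Suc r) i \<le> chain S r (Suc i) \<and> chain S r (Suc i) \<le> Suc (chain S (Suc r) i)" for r i
    using assms chain_Suc[of r S i] count_list_sorted[of "new_rows S r" i] chain_out[of S]
    unfolding regular_def by (cases "r < length S") auto
  then show ?thesis using assms chain_out[of S] unfolding regular_def shape_chain_def by auto
qed

text \<open>By \<open>chain_Suc\<close> a row belongs to \<open>new_rows S r\<close> exactly when
  the two shapes differ there, so the first gap found by \<open>pass_least\<close> is the first row
  of agreement. This links the path of \<open>k\<close> in uncrowding with the star path.\<close>

lemma next_row_pass:
  assumes "regular S" and "r < length S"
  shows "next_row (chain S) r i (Suc (pass (new_rows S r) i))"
proof -
  have s: "sorted_wrt (<) (new_rows S r)" using assms unfolding regular_def by auto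
  have "chain S r j' = Suc (chain S (Suc r) (j' - 1))" if j': "i < j'" "j' < Suc (pass (new_rows S r) i)" for j'
  proof -
    obtain j where j: "j' = Suc j" using j' by (cases j') auto
    then show ?thesis
      using pass_least[OF s, of i] j' chain_Suc[OF assms(2), of j] count_list_sorted[OF s, of j]
      by auto
  qed
  then show ?thesis
    using pass_least[OF s, of i] chain_Suc[OF assms(2)] count_list_sorted[OF s]
    unfolding next_row_def by auto
qed

text \<open>The extra letters of \<open>R\<close> carry \<open>k\<close> to row
  \<open>pass ss i\<close>, and the minima of \<open>R\<close> put one more row below it. These
  minima are smaller than \<open>k\<close>, so again no \<open>k\<close> lies in a row below the new
  one.\<close>

lemma uncrowded_Cons_add_cell:
  assumes "uncrowded Z' = add_cell i k (uncrowded Z)"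
    and "\<forall>R\<in>set (uncrowded Z). \<forall>y\<in>set R. y \<le> k"
    and "\<forall>R\<in>set (take i (uncrowded Z)). k \<notin> set R" and "i \<le> length (uncrowded Z)"
    and "\<forall>x\<in>set (extras R). x < k" and "\<forall>A\<in>set R. Min A < k"
  defines "ss \<equiv> snd (ins_word (extras R) (uncrowded Z))"
  shows "uncrowded (R # Z') = add_cell (Suc (pass ss i)) k (uncrowded (R # Z)) \<and>
    snd (ins_word (extras R) (uncrowded Z')) = push ss i \<and>
    (\<forall>R'\<in>set (take (Suc (pass ss i)) (uncrowded (R # Z))). k \<notin> set R') \<and>
    Suc (pass ss i) \<le> length (uncrowded (R # Z))"
proof -
  have "ins_word (extras R) (uncrowded Z) = (fst (ins_word (extras R) (uncrowded Z)), ss)"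
    unfolding ss_def by simp
  from ins_word_add_cell[OF this assms(5,2,3,4)] show ?thesis
    using assms(1,6) by auto
qed

lemma path_exists:
  assumes len: "length S' = length S" and n: "n < length S" and same: "\<forall>r<n. S' ! r = S ! r"
    and bd: "cells_bounded k S"
    and small: "\<forall>r<n. \<forall>A\<in>set (S ! r). \<forall>a\<in>A. a < k"
    and top: "uncrowded (drop n S') = add_cell j k (uncrowded (drop n S))"
      "\<forall>R\<in>set (take j (uncrowded (drop n S))). k \<notin> set R" "j \<le> length (uncrowded (drop n S))"
  obtains J where "J n = j"
    and "\<And>r. r \<le> n \<Longrightarrow> uncrowded (drop r S') = add_cell (J r) k (uncrowded (drop r S)) \<and>
           J r \<le> length (uncrowded (drop r S))"
    and "\<And>r. r < n \<Longrightarrow> J r = Suc (pass (new_rows S r) (J (Suc r))) \<and>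
           new_rows S' r = push (new_rows S r) (J (Suc r))"
proof -
  \<comment> \<open>Recursion from row \<open>n\<close> downwards: the value at depth
    \<open>Suc d\<close> belongs to row \<open>n - Suc d\<close> of \<open>S\<close>.\<close>
  define J where "J r = rec_nat j (\<lambda>d x. Suc (pass (new_rows S (n - Suc d)) x)) (n - r)" for r
  have Jn: "J n = j" unfolding J_def by simp
  have JS: "J r = Suc (pass (new_rows S r) (J (Suc r)))" if "r < n" for r
  proof -
    have "n - r = Suc (n - Suc r)" "n - Suc (n - Suc r) = r" using that by auto
    then show ?thesis unfolding J_def by simp
  qed
  have main: "uncrowded (drop r S') = add_cell (J r) k (uncrowded (drop r S)) \<and>
      (\<forall>R\<in>set (take (J r) (uncrowded (drop r S))). k \<notin> set R) \<and>
      J r \<le> length (uncrowded (drop r S)) \<and> (r < n \<longrightarrow> new_rows S' r = push (new_rows S r) (J (Suc r)))"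
    if "r \<le> n" for r
    using that
  proof (induction rule: inc_induct)
    case base
    then show ?case using top Jn by auto
  next
    case (step r)
    have r: "r < length S" "r < length S'" using step n len by auto
    have fin: "finite A \<and> A \<noteq> {}" if "A \<in> set (S ! r)" for A
      using bd r that unfolding cells_bounded_def by (metis finite_atMost finite_subset nth_mem)
    have ex: "\<forall>x\<in>set (extras (S ! r)). x < k"
      using extras_subset[of "S ! r"] fin small step by fastforce
    have mn: "\<forall>A\<in>set (S ! r). Min A < k" using fin small step by auto
    have "S' ! r = S ! r" using same step by auto
    have nr: "snd (ins_word (extras (S ! r)) (uncrowded (drop (Suc r) S))) = new_rows S r"
      "snd (ins_word (extras (S ! r)) (uncrowded (drop (Suc r) S'))) = new_rows S' r"
      using \<open>S' ! r = S ! r\<close> unfolding new_rows_def by simp_all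
    have dS: "drop r S = S ! r # drop (Suc r) S" "drop r S' = S ! r # drop (Suc r) S'"
      using Cons_nth_drop_Suc[OF r(1)] Cons_nth_drop_Suc[OF r(2)] \<open>S' ! r = S ! r\<close> by simp_all
    have IH: "uncrowded (drop (Suc r) S') = add_cell (J (Suc r)) k (uncrowded (drop (Suc r) S))"
      "\<forall>R\<in>set (take (J (Suc r)) (uncrowded (drop (Suc r) S))). k \<notin> set R"
      "J (Suc r) \<le> length (uncrowded (drop (Suc r) S))" using step.IH by blast+
    show ?case
      using uncrowded_Cons_add_cell[OF IH(1) uncrowded_bounded[OF cells_bounded_drop[OF bd]] IH(2,3) ex mn]
      unfolding nr dS[symmetric] JS[OF step.hyps(2)] by blast
  qed
  show ?thesis
  proof (rule that[of J])
    show "J n = j" by (fact Jn)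
  next
    fix r assume "r \<le> n"
    then show "uncrowded (drop r S') = add_cell (J r) k (uncrowded (drop r S)) \<and>
           J r \<le> length (uncrowded (drop r S))" using main[of r] by blast
  next
    fix r assume "r < n"
    then show "J r = Suc (pass (new_rows S r) (J (Suc r))) \<and>
           new_rows S' r = push (new_rows S r) (J (Suc r))" using JS[of r] main[of r] by auto
  qed
qed

text \<open>Shows that the enlarged shapes remain partitions. In \<open>a r\<close> the row below
  \<open>J r\<close> is either \<open>J (Suc r)\<close> itself or one where the strip has a cell,
  and in both cases it is strictly longer than row \<open>J r\<close>.\<close>

lemma path_addable:
  assumes a: "shape_chain l a" and "J n = 0" and "\<forall>r<n. next_row a r (J (Suc r)) (J r)"
    and "0 < n \<longrightarrow> a n 0 < a (n - 1) 0" and "r < n"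
  shows "a r (J r) < a r (J r - 1)"
proof -
  have anti: "a s (Suc i) \<le> a s i" "a (Suc s) i \<le> a s (Suc i)" for s i
    using a unfolding shape_chain_def by auto
  have key: "a s (J s) < a s (J s - 1)" if "s < n" "a (Suc s) (J (Suc s)) < a s (J (Suc s))" for s
  proof -
    let ?i = "J (Suc s)"
    have nx: "next_row a s ?i (J s)" using assms(3) that by auto
    then have lt: "?i < J s" and eq: "a s (J s) = a (Suc s) (J s - 1)" unfolding next_row_def by auto
    show ?thesis
    proof (cases "J s - 1 = ?i")
      case True
      then show ?thesis using eq that by simp
    next
      case False
      then have "?i < J s - 1 \<and> J s - 1 < J s" using lt by auto
      then have "a s (J s - 1) = Suc (a (Suc s) (J s - 1 - 1))"
        using nx unfolding next_row_def by blast
      moreover have "a (Suc s) (J s - 1) \<le> a (Suc s) (J s - 1 - 1)"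
        using anti(1)[of "Suc s" "J s - 1 - 1"] \<open>?i < J s - 1 \<and> J s - 1 < J s\<close>
        by (metis Suc_diff_1 gr_zeroI not_less_zero)
      ultimately show ?thesis using eq by simp
    qed
  qed
  \<comment> \<open>Downward induction: a cell addable to \<open>a (Suc r)\<close> in row
    \<open>J (Suc r)\<close> gives strict inequality against the row below, whose length is at most
    \<open>a r (J (Suc r))\<close>. The base is the corner condition.\<close>
  have "a (Suc r) (J (Suc r)) < a r (J (Suc r))"
  proof -
    have "r \<le> n - 1" using assms(5) by auto
    then show ?thesis
    proof (induction rule: inc_induct)
      case base
      then show ?case using assms(2,4,5) by (cases n) auto
    next
      case (step r)
      have "a (Suc r) (J (Suc r)) < a (Suc r) (J (Suc r) - 1)" using step key[of "Suc r"] by auto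
      also have "\<dots> \<le> a r (J (Suc r))"
        using anti(2)[of r "J (Suc r) - 1"] assms(3) step
        by (metis Suc_diff_1 Suc_lessD calculation diff_0_eq_0 gr_zeroI less_irrefl)
      finally show ?case .
    qed
  qed
  then show ?thesis using key assms(5) by blast
qed

section \<open>The predicted pair of tableaux and its change under one insertion\<close>

definition star_state :: "nat set list list \<Rightarrow> nat list list \<times> nat list list" where
  "star_state S = (block_rows (length S) (chain S) 0 (length (uncrowded S)), uncrowded S)"

lemma chain_path:
  assumes len: "length S' = length S" and n: "n < length S"
    and above: "drop (Suc n) S' = drop (Suc n) S"
    and J: "\<And>r. r \<le> n \<Longrightarrow> uncrowded (drop r S') = add_cell (J r) k (uncrowded (drop r S)) \<and>
           J r \<le> length (uncrowded (drop r S))"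
  shows "chain S' = add_path (chain S) J (Suc n)"
proof (intro ext)
  fix r i
  show "chain S' r i = add_path (chain S) J (Suc n) r i"
  proof (cases "r \<le> n")
    case True
    then show ?thesis using J[OF True] row_len_add_cell[of "J r" "uncrowded (drop r S)" k i]
      unfolding chain_def add_path_def by auto
  next
    case False
    then have "drop r S' = drop r S"
      using arg_cong[OF above, of "drop (r - Suc n)"] by simp
    then show ?thesis using False unfolding chain_def add_path_def by simp
  qed
qed

lemma star_state_path:
  assumes len: "length S' = length S" and n: "n < length S"
    and J: "uncrowded S' = add_cell (J 0) k (uncrowded S)" "J 0 \<le> length (uncrowded S)"
    and ch: "chain S' = add_path (chain S) J (Suc n)"
    and star: "star_rows x (block_rows (length S) (chain S) 0 (length (uncrowded S))) =
      (block_rows (length S) (add_path (chain S) J (Suc n)) 0 (max (length (uncrowded S)) (Suc (J 0))), J 0)"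
  shows "star_step (k, x) (star_state S) = star_state S'"
  using star J length_add_cell[OF J(2), of k] ch len
  unfolding star_step_def star_state_def by simp

lemma chain_beyond: "\<forall>i\<ge>length (uncrowded S). chain S 0 i = 0"
  unfolding chain_def row_len_def by simp

lemma antitone_add_path:
  assumes "\<forall>r i. a r (Suc i) \<le> a r i" and "\<And>r. r < n \<Longrightarrow> J r \<noteq> 0 \<Longrightarrow> a r (J r) < a r (J r - 1)"
  shows "\<forall>r i. add_path a J n r (Suc i) \<le> add_path a J n r i"
proof (intro allI)
  fix r i
  show "add_path a J n r (Suc i) \<le> add_path a J n r i"
    using assms(1)[rule_format, of r i] assms(2)[of r]
    by (cases "J r = Suc i") (auto simp: add_path_def)
qed

text \<open>A new singleton cell contributes a minimum and no extra letter, so the path of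
  \<open>k\<close> starts in row 0 of the uncrowding from row \<open>n\<close>.\<close>

lemma star_step_new_cell:
  assumes reg: "regular S" and n: "n < length S" and bd: "cells_bounded k S"
    and small: "\<forall>r<n. \<forall>A\<in>set (S ! r). \<forall>a\<in>A. a < k"
    and corner: "0 < n \<longrightarrow> length (S ! n) < length (S ! (n - 1))"
  defines "S' \<equiv> S[n := S ! n @ [{k}]]"
  shows "regular S' \<and> star_step (k, length S - n + length (S ! n)) (star_state S) = star_state S'"
proof -
  have len: "length S' = length S" and same: "\<forall>r<n. S' ! r = S ! r"
    and above: "drop (Suc n) S' = drop (Suc n) S" unfolding S'_def by auto
  have dropS: "drop n S = S ! n # drop (Suc n) S" using n by (simp add: Cons_nth_drop_Suc)
  have dropS': "drop n S' = (S ! n @ [{k}]) # drop (Suc n) S"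
    using n above len by (metis Cons_nth_drop_Suc S'_def nth_list_update_eq)
  have "uncrowded (drop n S') = add_cell 0 k (uncrowded (drop n S))"
    using dropS dropS' by (simp add: extras_append_singleton)
  then obtain J where J: "J n = 0"
    "\<And>r. r \<le> n \<Longrightarrow> uncrowded (drop r S') = add_cell (J r) k (uncrowded (drop r S)) \<and>
           J r \<le> length (uncrowded (drop r S))"
    "\<And>r. r < n \<Longrightarrow> J r = Suc (pass (new_rows S r) (J (Suc r))) \<and>
           new_rows S' r = push (new_rows S r) (J (Suc r))"
    using path_exists[OF len n same bd small, of 0] by auto
  have ch: "chain S' = add_path (chain S) J (Suc n)"
    using chain_path[OF len n above J(2)] by blast
  have sc: "shape_chain (length S) (chain S)" using regular_shape_chain[OF reg] .
  have nx: "\<forall>s<n. next_row (chain S) s (J (Suc s)) (J s)"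
    using next_row_pass[OF reg] J(3) n by (metis order_less_trans)
  have cc: "0 < n \<longrightarrow> chain S n 0 < chain S (n - 1) 0"
    using corner n chain_0[of n S] chain_0[of "n - 1" S] by auto
  have N: "0 < length (uncrowded S)" using length_uncrowded[of S] n by auto
  have star: "star_step (k, length S - n + length (S ! n)) (star_state S) = star_state S'"
    using star_rows_new_cell[OF sc n cc J(1) nx chain_beyond N] J(2)[of 0] chain_0[OF n]
    by (intro star_state_path[OF len n _ _ ch]) auto
  have nr: "new_rows S' n = new_rows S n"
    using above n unfolding new_rows_def S'_def by (simp add: extras_append_singleton)
  have "sorted_wrt (<) (new_rows S' r)" if r: "r < length S'" for r
  proof -
    have s: "sorted_wrt (<) (new_rows S r)" using reg r len unfolding regular_def by auto
    consider "r < n" | "r = n" | "n < r" by linarith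
    then show ?thesis
    proof cases
      case 1 then show ?thesis using sorted_push[OF s] J(3) by auto
    next
      case 2 then show ?thesis using s nr by auto
    next
      case 3
      then have "drop (Suc r) S' = drop (Suc r) S" "S' ! r = S ! r" unfolding S'_def by auto
      then show ?thesis using s unfolding new_rows_def by simp
    qed
  qed
  moreover have "\<forall>r i. chain S' r (Suc i) \<le> chain S' r i"
    unfolding ch
  proof (rule antitone_add_path)
    show "\<forall>r i. chain S r (Suc i) \<le> chain S r i" using reg unfolding regular_def by auto
    show "chain S r (J r) < chain S r (J r - 1)" if "r < Suc n" "J r \<noteq> 0" for r
      using path_addable[OF sc J(1) nx cc, of r] that J(1) by (cases "r = n") auto
  qed
  ultimately show ?thesis using star unfolding regular_def by auto
qed

text \<open>Here \<open>k\<close> is the first extra letter of row \<open>n\<close>, so its path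
  starts in the uncrowding of the rows above \<open>n\<close>.\<close>

lemma star_step_extra:
  assumes reg: "regular S" and n: "n < length S" and bd: "cells_bounded k S"
    and small: "\<forall>r\<le>n. \<forall>A\<in>set (S ! r). \<forall>a\<in>A. a < k"
    and row: "S ! n = R @ [A]"
    and corner: "Suc n < length S \<longrightarrow> length (S ! Suc n) < length (S ! n)"
  defines "S' \<equiv> S[n := R @ [insert k A]]"
  shows "regular S' \<and> star_step (k, length S - n + length R) (star_state S) = star_state S'"
proof -
  have len: "length S' = length S" and same: "\<forall>r<n. S' ! r = S ! r"
    and above: "drop (Suc n) S' = drop (Suc n) S" unfolding S'_def by auto
  have fin: "finite B \<and> B \<noteq> {} \<and> (\<forall>a\<in>B. a < k)" if "B \<in> set (S ! n)" for B
    using bd n that small unfolding cells_bounded_def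
    by (metis finite_atMost finite_subset nth_mem order_refl)
  then have A: "finite A" "A \<noteq> {}" "\<forall>a\<in>A. a < k" using row by auto
  have ex: "\<forall>x\<in>set (extras (S ! n)). x < k"
    using extras_subset[of "S ! n"] fin by fastforce
  have dropS: "drop n S = S ! n # drop (Suc n) S" using n by (simp add: Cons_nth_drop_Suc)
  have dropS': "drop n S' = (R @ [insert k A]) # drop (Suc n) S"
    using n above len by (metis Cons_nth_drop_Suc S'_def nth_list_update_eq)
  let ?Z = "uncrowded (drop (Suc n) S)" and ?ss = "new_rows S n"
  obtain W where W: "ins_word (extras (S ! n)) ?Z = (W, ?ss)"
    unfolding new_rows_def by (metis prod.collapse)
  have Z: "\<forall>R\<in>set ?Z. \<forall>y\<in>set R. y \<le> k" using uncrowded_bounded[OF cells_bounded_drop[OF bd]] .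
  have iw: "ins_word (extras (S ! n)) (add_cell 0 k ?Z) = (add_cell (pass ?ss 0) k W, push ?ss 0) \<and>
    (\<forall>R\<in>set (take (pass ?ss 0) W). k \<notin> set R) \<and> pass ?ss 0 \<le> length W"
    using ins_word_add_cell[OF W ex Z, of 0] by auto
  have ex': "extras (R @ [insert k A]) = k # extras (S ! n)" "Min (insert k A) = Min A"
    using extras_insert_max[OF A] row by auto
  \<comment> \<open>Inserted first and not smaller than any letter present, \<open>k\<close> goes to
    the end of row 0; the remaining extra letters then push it up.\<close>
  have iw': "ins_word (extras (R @ [insert k A])) ?Z = (add_cell (pass ?ss 0) k W, 0 # push ?ss 0)"
    using iw ex' ins_rows_max[OF Z] by simp
  have mins: "map Min (R @ [insert k A]) = map Min (S ! n)" using ex' row by simp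
  have "k \<notin> set (map Min (S ! n))"
  proof
    assume "k \<in> set (map Min (S ! n))"
    then obtain B where "B \<in> set (S ! n)" "k = Min B" by auto
    then show False using fin[of B] Min_in[of B] by blast
  qed
  then have top: "uncrowded (drop n S') = add_cell (Suc (pass ?ss 0)) k (uncrowded (drop n S))"
     "\<forall>R\<in>set (take (Suc (pass ?ss 0)) (uncrowded (drop n S))). k \<notin> set R"
     "Suc (pass ?ss 0) \<le> length (uncrowded (drop n S))"
    using dropS dropS' iw iw' W mins by (auto simp del: map_append)
  have small': "\<forall>r<n. \<forall>A\<in>set (S ! r). \<forall>a\<in>A. a < k" using small less_imp_le by blast
  obtain J0 where J0: "J0 n = Suc (pass ?ss 0)"
    "\<And>r. r \<le> n \<Longrightarrow> uncrowded (drop r S') = add_cell (J0 r) k (uncrowded (drop r S)) \<and>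
           J0 r \<le> length (uncrowded (drop r S))"
    "\<And>r. r < n \<Longrightarrow> J0 r = Suc (pass (new_rows S r) (J0 (Suc r))) \<and>
           new_rows S' r = push (new_rows S r) (J0 (Suc r))"
    using path_exists[OF len n same bd small' top] by metis
  \<comment> \<open>The value 0 records where \<open>k\<close> enters the rows above
    \<open>n\<close>, so that row \<open>n\<close> obeys the same rule as the rows below it and
    \<open>path_addable\<close> applies with \<open>Suc n\<close>.\<close>
  define J where "J = J0(Suc n := 0)"
  have J: "J (Suc n) = 0" "J n = Suc (pass ?ss 0)"
    "\<And>r. r \<le> n \<Longrightarrow> uncrowded (drop r S') = add_cell (J r) k (uncrowded (drop r S)) \<and>
           J r \<le> length (uncrowded (drop r S))"
    "\<And>r. r < n \<Longrightarrow> J r = Suc (pass (new_rows S r) (J (Suc r))) \<and>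
           new_rows S' r = push (new_rows S r) (J (Suc r))"
    using J0 unfolding J_def by auto
  have ch: "chain S' = add_path (chain S) J (Suc n)"
    using chain_path[OF len n above J(3)] by blast
  have sc: "shape_chain (length S) (chain S)" using regular_shape_chain[OF reg] .
  have nx: "\<forall>s<Suc n. next_row (chain S) s (J (Suc s)) (J s)"
    using next_row_pass[OF reg] J n by (metis less_Suc_eq order_less_trans)
  then have nxn: "next_row (chain S) n 0 (J n)" and nx': "\<forall>s<n. next_row (chain S) s (J (Suc s)) (J s)"
    using J(1) by (metis lessI, auto)
  have cc: "chain S (Suc n) 0 < chain S n 0"
    using corner n chain_0[of n S] chain_0[of "Suc n" S] chain_out[of S "Suc n"] row
    by (cases "Suc n < length S") auto
  then have cc': "0 < Suc n \<longrightarrow> chain S (Suc n) 0 < chain S (Suc n - 1) 0" by simp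
  have N: "0 < length (uncrowded S)" using length_uncrowded[of S] n by auto
  have star: "star_step (k, length S - n + length R) (star_state S) = star_state S'"
    using star_rows_extra[OF sc n cc nxn nx' chain_beyond N] J(3)[of 0] chain_0[OF n] row
    by (intro star_state_path[OF len n _ _ ch]) auto
  have nr: "new_rows S' n = 0 # push ?ss 0"
    using above n iw' unfolding new_rows_def S'_def by simp
  have "sorted_wrt (<) (new_rows S' r)" if r: "r < length S'" for r
  proof -
    have s: "sorted_wrt (<) (new_rows S r)" using reg r len unfolding regular_def by auto
    consider "r < n" | "r = n" | "n < r" by linarith
    then show ?thesis
    proof cases
      case 1 then show ?thesis using sorted_push[OF s] J(4) by auto
    next
      case 2 then show ?thesis using s nr sorted_push[OF s] push_greater[OF s, of 0] by auto
    next
      case 3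
      then have "drop (Suc r) S' = drop (Suc r) S" "S' ! r = S ! r" unfolding S'_def by auto
      then show ?thesis using s unfolding new_rows_def by simp
    qed
  qed
  moreover have "\<forall>r i. chain S' r (Suc i) \<le> chain S' r i"
    unfolding ch
  proof (rule antitone_add_path)
    show "\<forall>r i. chain S r (Suc i) \<le> chain S r i" using reg unfolding regular_def by auto
    show "chain S r (J r) < chain S r (J r - 1)" if "r < Suc n" for r
      using path_addable[OF sc J(1) nx cc' that] .
  qed
  ultimately show ?thesis using star unfolding regular_def by auto
qed

text \<open>
  \<open>star_state\<close> keeps empty rows on top of both tableaux, whereas the insertion starts from
  tableaux without rows.
\<close>

lemma star_rows_pad:
  "\<exists>n'. star_rows x (P @ replicate n []) = (fst (star_rows x P) @ replicate n' [], snd (star_rows x P)) \<and>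
     length P + n = length (fst (star_rows x P)) + n' \<or>
   n = 0"
proof (induction P arbitrary: x)
  case Nil
  show ?case by (cases n) (auto simp: star_row_def)
next
  case (Cons R P)
  obtain R' o' where b: "star_row x R = (R', o')" by fastforce
  show ?case
  proof (cases o')
    case None
    then show ?thesis using b by auto
  next
    case (Some y)
    then show ?thesis using b Cons[of y] by (auto simp: case_prod_beta)
  qed
qed

lemma length_star_rows:
  "snd (star_rows x P) \<le> length P \<and> length (fst (star_rows x P)) = max (length P) (Suc (snd (star_rows x P)))"
proof (induction P arbitrary: x)
  case (Cons R P)
  obtain R' o' where b: "star_row x R = (R', o')" by fastforce
  show ?case
    using b Cons[of "the o'"] by (cases o') (auto simp: case_prod_beta)
qed auto

lemma add_cell_pad:
  assumes "r \<le> length Q" and "length Q + n = max (length Q) (Suc r) + n'"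
  shows "add_cell r q (Q @ replicate n []) = add_cell r q Q @ replicate n' []"
proof (cases "r < length Q")
  case True
  then show ?thesis using assms by (auto simp: add_cell_def list_update_append nth_append)
next
  case False
  then have "r = length Q" "n = Suc n'" using assms by auto
  then show ?thesis by (simp add: add_cell_def nth_append)
qed

lemma foldr_star_step_pad:
  defines "st \<equiv> \<lambda>es. foldr star_step es ([], [])"
  shows "length (fst (st es)) = length (snd (st es)) \<and>
    (\<exists>n'. foldr star_step es (replicate n [], replicate n []) =
       (fst (st es) @ replicate n' [], snd (st es) @ replicate n' []))"
proof (induction es)
  case Nil
  show ?case unfolding st_def by simp
next
  case (Cons e es)
  obtain q x where e: "e = (q, x)" by fastforce
  obtain P Q where PQ: "st es = (P, Q)" by fastforce
  obtain n1 where n1: "foldr star_step es (replicate n [], replicate n []) =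
       (P @ replicate n1 [], Q @ replicate n1 [])" and len: "length P = length Q"
    using Cons PQ by auto
  obtain P' r where P': "star_rows x P = (P', r)" by fastforce
  have st': "st (e # es) = (P', add_cell r q Q)"
    using PQ P' unfolding st_def e star_step_def by simp
  have r: "r \<le> length P" "length P' = max (length P) (Suc r)"
    using length_star_rows[of x P] P' by auto
  have len': "length P' = length (add_cell r q Q)" using r len length_add_cell[of r Q q] by auto
  show ?case
  \<comment> \<open>Once the padding is used up, the padded and the unpadded computation
    coincide.\<close>
  proof (cases "n1 = 0")
    case True
    then show ?thesis using st' n1 P' len' unfolding e star_step_def by (auto intro!: exI[of _ 0])
  next
    case False
    then obtain n2 where "star_rows x (P @ replicate n1 []) = (P' @ replicate n2 [], r)"
      "length P + n1 = length P' + n2" using star_rows_pad[of x P n1] P' by auto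
    moreover have "add_cell r q (Q @ replicate n1 []) = add_cell r q Q @ replicate n2 []"
      using r len calculation(2) by (intro add_cell_pad) auto
    ultimately show ?thesis using st' n1 len' unfolding e star_step_def by auto
  qed
qed

section \<open>Empty rows and the initial state\<close>

lemma ins_rows_nonempty:
  "[] \<notin> set V \<Longrightarrow> [] \<notin> set (fst (ins_rows x V))"
proof (induction V arbitrary: x)
  case (Cons R V)
  obtain R' o' where b: "row_bump x R = (R', o')" by fastforce
  have "length R \<le> length R'" using b by (cases o') (auto simp: row_bump_None row_bump_Some)
  then have "R' \<noteq> []" using Cons.prems by auto
  then show ?case using b Cons.IH[of "the o'"] Cons.prems by (cases o') (auto simp: case_prod_beta)
qed auto

lemma ins_word_nonempty:
  "[] \<notin> set V \<Longrightarrow> [] \<notin> set (fst (ins_word xs V))"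
proof (induction xs arbitrary: V)
  case (Cons x xs)
  then show ?case using Cons.IH[of "fst (ins_rows x V)"] ins_rows_nonempty[of V x]
    by (auto simp: case_prod_beta)
qed auto

lemma uncrowded_nonempty: "[] \<notin> set S \<Longrightarrow> [] \<notin> set (uncrowded S)"
  by (induction S) (auto simp: ins_word_nonempty)

lemma uncrowded_replicate: "uncrowded (replicate n []) = replicate n []"
  by (induction n) (auto simp: extras_def)

lemma initial_state:
  "regular (replicate n [])" "star_state (replicate n []) = (replicate n [], replicate n [])"
proof -
  have ch: "chain (replicate n []) r i = 0" for r i
    unfolding chain_def row_len_def by (simp add: uncrowded_replicate)
  then show "regular (replicate n [])"
    unfolding regular_def new_rows_def by (simp add: extras_def)
  have "block_rows n (chain (replicate n [])) 0 n = replicate n []"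
    unfolding block_rows_def block_row_def ch by (simp add: map_replicate_const)
  then show "star_state (replicate n []) = (replicate n [], replicate n [])"
    unfolding star_state_def by (simp add: uncrowded_replicate)
qed

lemma length_filter_map_ge:
  assumes "\<forall>j<m. P (f j)" and "m \<le> n"
  shows "m \<le> length (filter P (map f [0..<n]))"
proof -
  have "filter P (map f [0..<m]) = map f [0..<m]" using assms by (auto simp: filter_id_conv)
  moreover have "[0..<n] = [0..<m] @ [m..<n]" using assms(2) upt_add_eq_append[of 0 m "n - m"] by simp
  ultimately show ?thesis by simp
qed

lemma length_filter_map_le:
  assumes "\<forall>j. m \<le> j \<and> j < n \<longrightarrow> \<not> P (f j)"
  shows "length (filter P (map f [0..<n])) \<le> m"
proof (cases "m \<le> n")
  case True
  have "filter P (map f [m..<n]) = []" using assms by (auto simp: filter_empty_conv)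
  moreover have "[0..<n] = [0..<m] @ [m..<n]" using True upt_add_eq_append[of 0 m "n - m"] by simp
  ultimately show ?thesis using length_filter_le[of P "map f [0..<m]"] by simp
next
  case False
  then show ?thesis using length_filter_le[of P "map f [0..<n]"] by simp
qed

subsection \<open>Building a set-valued tableau entry by entry\<close>

text \<open>The order conditions compare elements instead of \<open>Max\<close> and
  \<open>Min\<close>, which suits the removal of single letters.\<close>

locale straight_svt =
  fixes M :: nat and S :: "nat set list list"
  assumes cell: "\<And>r c. r < length S \<Longrightarrow> c < length (S ! r) \<Longrightarrow> S ! r ! c \<noteq> {} \<and> S ! r ! c \<subseteq> {1..M}"
    and shape: "\<And>r. Suc r < length S \<Longrightarrow> length (S ! Suc r) \<le> length (S ! r)"
    and row: "\<And>r c a b. r < length S \<Longrightarrow> Suc c < length (S ! r) \<Longrightarrow> a \<in> S ! r ! c \<Longrightarrow>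
                b \<in> S ! r ! Suc c \<Longrightarrow> a \<le> b"
    and column: "\<And>r c a b. Suc r < length S \<Longrightarrow> c < length (S ! Suc r) \<Longrightarrow> a \<in> S ! r ! c \<Longrightarrow>
                b \<in> S ! Suc r ! c \<Longrightarrow> a < b"
begin

lemma shape_mono: "r \<le> s \<Longrightarrow> s < length S \<Longrightarrow> length (S ! s) \<le> length (S ! r)"
proof (induction s rule: dec_induct)
  case (step s)
  then show ?case using shape[of s] by auto
qed simp

lemma row_le:
  assumes "c < d" and "r < length S" and "d < length (S ! r)" and "a \<in> S ! r ! c" and "b \<in> S ! r ! d"
  shows "a \<le> b"
  using assms
proof (induction d arbitrary: b)
  case (Suc d)
  show ?case
  proof (cases "c = d")
    case True
    then show ?thesis using row[of r d a b] Suc.prems by simp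
  next
    case False
    obtain x where x: "x \<in> S ! r ! d" using cell[of r d] Suc.prems by fastforce
    have "a \<le> x" using Suc.IH[OF _ _ _ _ x] Suc.prems False by simp
    also have "x \<le> b" using row[of r d x b] x Suc.prems by auto
    finally show ?thesis .
  qed
qed simp

lemma column_less:
  assumes "r < s" and "s < length S" and "c < length (S ! s)" and "a \<in> S ! r ! c" and "b \<in> S ! s ! c"
  shows "a < b"
  using assms
proof (induction s arbitrary: b)
  case (Suc s)
  show ?case
  proof (cases "r = s")
    case True
    then show ?thesis using column[of s c a b] Suc.prems by simp
  next
    case False
    have c: "c < length (S ! s)" using shape[of s] Suc.prems by auto
    obtain x where x: "x \<in> S ! s ! c" using cell[of s c] Suc.prems c by fastforce
    have "a < x" using Suc.IH[OF _ _ c _ x] Suc.prems False by simp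
    also have "x < b" using column[of s c x b] x Suc.prems by auto
    finally show ?thesis .
  qed
qed simp

text \<open>Compare both cells with the one in row \<open>r\<close> and column \<open>d\<close>. In
  particular no letter occurs twice on a diagonal.\<close>

lemma cell_less:
  assumes "r < s" and "c \<le> d" and "s < length S" and "d < length (S ! s)"
    and "a \<in> S ! r ! c" and "b \<in> S ! s ! d"
  shows "a < b"
proof (cases "c = d")
  case True
  then show ?thesis using column_less[of r s c a b] assms by simp
next
  case False
  have d: "d < length (S ! r)" using shape_mono[of r s] assms by auto
  obtain x where x: "x \<in> S ! r ! d" using cell[of r d] assms d by fastforce
  have "a \<le> x" using row_le[of c d r a x] x assms d False by auto
  also have "x < b" using column_less[of r s d x b] x assms by auto
  finally show ?thesis .
qed

text \<open>
  \<open>part_svt k c\<close> keeps the letters below \<open>k\<close> and those letters \<open>k\<close> whose content is below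
  \<open>c\<close>. Cells that become empty are dropped; they lie at the ends of the rows.
\<close>

definition part_cell :: "nat \<Rightarrow> nat \<Rightarrow> nat \<Rightarrow> nat \<Rightarrow> nat set" where
  "part_cell k c r j = {a \<in> S ! r ! j. a < k \<or> a = k \<and> length S + j - r < c}"

definition part_row :: "nat \<Rightarrow> nat \<Rightarrow> nat \<Rightarrow> nat set list" where
  "part_row k c r = filter (\<lambda>A. A \<noteq> {}) (map (part_cell k c r) [0..<length (S ! r)])"

definition part_svt :: "nat \<Rightarrow> nat \<Rightarrow> nat set list list" where
  "part_svt k c = map (part_row k c) [0..<length S]"

definition diagonals :: "nat \<Rightarrow> nat set" where
  "diagonals k = {length S + j - r |r j. r < length S \<and> j < length (S ! r) \<and> k \<in> S ! r ! j}"

lemma length_part_svt [simp]: "length (part_svt k c) = length S"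
  unfolding part_svt_def by simp

lemma part_svt_nth: "r < length S \<Longrightarrow> part_svt k c ! r = part_row k c r"
  unfolding part_svt_def by simp

lemma cells_bounded_part_svt: "cells_bounded k (part_svt k c)"
  unfolding cells_bounded_def part_svt_def part_row_def part_cell_def by auto

lemma part_svt_skip:
  assumes "c \<notin> diagonals k"
  shows "part_svt k (Suc c) = part_svt k c"
proof -
  have "part_cell k (Suc c) r j = part_cell k c r j" if "r < length S" "j < length (S ! r)" for r j
    using assms that unfolding part_cell_def diagonals_def by (auto simp: less_Suc_eq)
  then show ?thesis unfolding part_svt_def part_row_def by (auto intro!: arg_cong[where f = "filter _"])
qed

text \<open>Only one cell of content \<open>c\<close> contains \<open>k\<close>. If it already holds
  smaller letters, \<open>k\<close> becomes an extra letter; otherwise \<open>k\<close> opens a new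
  cell at the end of its row.\<close>

lemma part_svt_step:
  assumes "c \<in> diagonals k" and reg: "regular (part_svt k c)"
  shows "regular (part_svt k (Suc c)) \<and>
         star_step (k, c) (star_state (part_svt k c)) = star_state (part_svt k (Suc c))"
proof -
  obtain r j where r: "r < length S" and j: "j < length (S ! r)" and k: "k \<in> S ! r ! j"
    and c: "c = length S + j - r" using assms(1) unfolding diagonals_def by auto
  define A where "A = {a \<in> S ! r ! j. a < k}"
  define R where "R = map ((!) (S ! r)) [0..<j]"
  \<comment> \<open>In row \<open>r\<close> the cells left of column \<open>j\<close> are already
    complete, and those to its right are still empty.\<close>
  have before: "part_cell k d r j' = S ! r ! j'" if "c \<le> d" "j' < j" for d j'
    using row_le[of j' j r _ k] that r j k c unfolding part_cell_def by fastforce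
  have after: "part_cell k d r j' = {}" if "d \<le> Suc c" "j < j'" "j' < length (S ! r)" for d j'
    using row_le[of j j' r k] that r j k c unfolding part_cell_def by fastforce
  have at: "part_cell k c r j = A" "part_cell k (Suc c) r j = insert k A"
    using k unfolding part_cell_def A_def c by auto
  have split: "[0..<length (S ! r)] = [0..<j] @ j # [Suc j..<length (S ! r)]"
    using j upt_add_eq_append[of 0 j "length (S ! r) - j"] by (simp add: upt_conv_Cons)
  have rows: "part_row k d r = R @ filter (\<lambda>A. A \<noteq> {}) [part_cell k d r j]" if "d = c \<or> d = Suc c" for d
  proof -
    have "filter (\<lambda>A. A \<noteq> {}) (map (part_cell k d r) [0..<j]) = R"
      using before[of d] that cell[of r] r j unfolding R_def
      by (subst filter_True) auto
    moreover have "filter (\<lambda>A. A \<noteq> {}) (map (part_cell k d r) [Suc j..<length (S ! r)]) = []"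
      using after[of d] that by (auto simp: filter_empty_conv)
    ultimately show ?thesis unfolding part_row_def split by simp
  qed
  have rowc: "part_svt k c ! r = R @ (if A = {} then [] else [A])"
    and rowSc: "part_row k (Suc c) r = R @ [insert k A]"
    using rows[of c] rows[of "Suc c"] at part_svt_nth[OF r] by auto
  have uniq: "r' = r" if q: "r' < length S" "j' < length (S ! r')" "k \<in> S ! r' ! j'" "length S + j' - r' = c" for r' j'
  proof (rule ccontr)
    assume "r' \<noteq> r"
    then consider "r' < r" "j' \<le> j" | "r < r'" "j \<le> j'" using q r c by linarith
    then show False
      using cell_less[of r' r j' j k k] cell_less[of r r' j j' k k] q r j k by cases auto
  qed
  have other: "part_row k (Suc c) r' = part_row k c r'" if "r' < length S" "r' \<noteq> r" for r'
  proof -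
    have "part_cell k (Suc c) r' j' = part_cell k c r' j'" if "j' < length (S ! r')" for j'
      using uniq[of r' j'] that \<open>r' < length S\<close> \<open>r' \<noteq> r\<close> unfolding part_cell_def by (auto simp: less_Suc_eq)
    then show ?thesis unfolding part_row_def by (auto intro!: arg_cong[where f = "filter _"])
  qed
  have upd: "part_svt k (Suc c) = (part_svt k c)[r := R @ [insert k A]]"
    by (rule nth_equalityI) (use other rowSc r in \<open>auto simp: part_svt_nth nth_list_update\<close>)
  \<comment> \<open>A letter \<open>k\<close> already kept in a lower row has smaller content, so it
    would lie weakly to the left, against \<open>cell_less\<close>.\<close>
  have small: "a < k" if q: "r' < r" "B \<in> set (part_svt k c ! r')" "a \<in> B" for r' B a
  proof -
    obtain j' where j': "j' < length (S ! r')" "a \<in> part_cell k c r' j'"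
      using q r unfolding part_svt_def part_row_def by auto
    have False if "a = k"
    proof -
      have "length S + j' - r' < c" "k \<in> S ! r' ! j'" using j' that unfolding part_cell_def by auto
      moreover from this have "j' \<le> j" using \<open>r' < r\<close> r c by linarith
      ultimately show False using cell_less[of r' r j' j k k] \<open>r' < r\<close> r j k by auto
    qed
    then show ?thesis using j' unfolding part_cell_def by auto
  qed
  have lenR: "length R = j" unfolding R_def by simp
  have c': "length (part_svt k c) - r + length R = c" using c r lenR by simp
  have r': "r < length (part_svt k c)" using r by simp
  show ?thesis
  proof (cases "A = {}")
    case True
    have "length (part_svt k c ! r) < length (part_svt k c ! (r - 1))" if "0 < r"
    proof -
      \<comment> \<open>In the row below, all cells up to column \<open>j\<close> hold only letters
        smaller than \<open>k\<close>, so that row is strictly longer at this time.\<close>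
      have "part_cell k c (r - 1) j' \<noteq> {}" if q: "j' < Suc j" for j'
      proof -
        have l: "j' < length (S ! (r - 1))" using shape_mono[of "r - 1" r] q r j by auto
        obtain a where a: "a \<in> S ! (r - 1) ! j'" using cell[of "r - 1" j'] l r by fastforce
        have "a < k" using cell_less[of "r - 1" r j' j a k] a q r j k \<open>0 < r\<close> by auto
        then show ?thesis using a unfolding part_cell_def by auto
      qed
      moreover have "Suc j \<le> length (S ! (r - 1))" using shape_mono[of "r - 1" r] r j by auto
      ultimately have "Suc j \<le> length (part_row k c (r - 1))"
        unfolding part_row_def by (intro length_filter_map_ge) auto
      then show ?thesis using rowc True lenR part_svt_nth[of "r - 1"] r by auto
    qed
    then show ?thesis
      using star_step_new_cell[OF reg r' cells_bounded_part_svt[of k c]] small True upd rowc c'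
      by simp
  next
    case False
    then obtain b where b: "b \<in> S ! r ! j" "b < k" unfolding A_def by auto
    have "a < k" if q: "B \<in> set (part_svt k c ! r)" "a \<in> B" for B a
    proof -
      have "B = A \<or> (\<exists>j'<j. B = S ! r ! j')"
        using q rowc False unfolding R_def by auto
      then consider "B = A" | j' where "j' < j" "B = S ! r ! j'" by blast
      then show ?thesis
      proof cases
        case 1
        then show ?thesis using q unfolding A_def by auto
      next
        case 2
        then show ?thesis using row_le[of j' j r a b] b q r j by auto
      qed
    qed
    then have sm: "\<forall>r'\<le>r. \<forall>B\<in>set (part_svt k c ! r'). \<forall>a\<in>B. a < k"
      using small by (metis le_neq_implies_less)
    have corner: "length (part_svt k c ! Suc r) < length (part_svt k c ! r)" if "Suc r < length S"
    proof -
      \<comment> \<open>In the row above, the cells from column \<open>j\<close> on hold only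
        letters larger than \<open>k\<close>, so that row still ends before column
        \<open>j\<close>.\<close>
      have "part_cell k c (Suc r) j' = {}" if "j \<le> j'" "j' < length (S ! Suc r)" for j'
        using cell_less[of r "Suc r" j j' k] that k \<open>Suc r < length S\<close> unfolding part_cell_def by fastforce
      then have "length (part_row k c (Suc r)) \<le> j"
        unfolding part_row_def by (intro length_filter_map_le) auto
      then show ?thesis using that rowc False lenR part_svt_nth by auto
    qed
    then have corner': "Suc r < length (part_svt k c) \<longrightarrow>
        length (part_svt k c ! Suc r) < length (part_svt k c ! r)" by simp
    have rowA: "part_svt k c ! r = R @ [A]" using rowc False by simp
    show ?thesis
      using star_step_extra[OF reg r' cells_bounded_part_svt[of k c] sm rowA corner']
      unfolding upd c' .
  qed
qed

section \<open>Reading the whole residue word\<close>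

lemma part_svt_factor:
  assumes "regular (part_svt k 0)"
  shows "regular (part_svt k n) \<and>
    foldr star_step (map (Pair k) (rev (filter (\<lambda>c. c \<in> diagonals k) [0..<n]))) (star_state (part_svt k 0)) =
    star_state (part_svt k n)"
proof (induction n)
  case (Suc n)
  then show ?case
    using part_svt_step[of n k] part_svt_skip[of n k] by (cases "n \<in> diagonals k") auto
qed (use assms in simp)

lemma part_svt_all:
  assumes C: "\<And>r j. r < length S \<Longrightarrow> j < length (S ! r) \<Longrightarrow> length S + j - r < C"
    and "regular (part_svt 1 0)"
  shows "regular (part_svt (Suc n) 0) \<and>
    foldr star_step (concat (map (\<lambda>k. map (Pair k) (rev (filter (\<lambda>c. c \<in> diagonals k) [0..<C])))
      (rev [1..<Suc n]))) (star_state (part_svt 1 0)) = star_state (part_svt (Suc n) 0)"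
proof (induction n)
  case (Suc n)
  \<comment> \<open>All contents are below \<open>C\<close>, so every \<open>k\<close> has been
    added and the next letter can begin.\<close>
  have "part_svt k C = part_svt (Suc k) 0" for k
    using C unfolding part_svt_def part_row_def part_cell_def
    by (intro map_cong refl arg_cong[where f = "filter _"]) (auto simp: less_Suc_eq)
  then show ?case using Suc part_svt_factor[of "Suc n" C] by simp
qed (use assms in simp)

lemma part_svt_initial: "part_svt 1 0 = replicate (length S) []"
proof (rule nth_equalityI)
  fix r assume r: "r < length (part_svt 1 0)"
  have "part_cell 1 0 r j = {}" if "j < length (S ! r)" for j
    using cell[of r j] that r unfolding part_cell_def by fastforce
  then show "part_svt 1 0 ! r = replicate (length S) [] ! r"
    using r by (auto simp: part_svt_nth part_row_def filter_empty_conv)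
qed simp

lemma part_svt_final: "part_svt (Suc M) 0 = S"
proof (rule nth_equalityI)
  fix r assume r: "r < length (part_svt (Suc M) 0)"
  then have "part_cell (Suc M) 0 r j = S ! r ! j" if "j < length (S ! r)" for j
    using cell[of r j] that unfolding part_cell_def by auto
  then have "map (part_cell (Suc M) 0 r) [0..<length (S ! r)] = S ! r"
    by (auto intro: map_nth[THEN trans[rotated]] map_cong)
  moreover have "filter (\<lambda>A. A \<noteq> {}) (S ! r) = S ! r"
    using cell[of r] r by (auto simp: filter_id_conv in_set_conv_nth)
  ultimately show "part_svt (Suc M) 0 ! r = S ! r" using r by (simp add: part_svt_nth part_row_def)
qed simp

theorem star_insertion_residue:
  assumes lam: "length lam = length S" "\<And>r. r < length S \<Longrightarrow> lam ! r = length (S ! r)"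
    and pos: "[] \<notin> set S"
  shows "snd (star_insertion (residue lam [] M S)) = uncrowded S"
proof -
  define C where "C = length S + sum_list (map length S)"
  have C: "length S + j - r < C" if "r < length S" "j < length (S ! r)" for r j
    using that member_le_sum_list[of "length (S ! r)" "map length S"] unfolding C_def by fastforce
  have diag: "content lam ` {z \<in> skew_cells lam []. k \<in> entry [] S z} = diagonals k" for k
    unfolding content_def skew_cells_def entry_def diagonals_def part_def using lam by (auto simp: image_iff) force
  have "sorted_list_of_set (diagonals k) = filter (\<lambda>c. c \<in> diagonals k) [0..<C]" for k
  proof -
    have "diagonals k = {c \<in> {0..<C}. c \<in> diagonals k}" using C unfolding diagonals_def by auto
    then have "set (filter (\<lambda>c. c \<in> diagonals k) [0..<C]) = diagonals k" by auto
    then show ?thesis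
      using sorted_list_of_set.idem_if_sorted_distinct[of "filter (\<lambda>c. c \<in> diagonals k) [0..<C]"]
      by (simp add: sorted_wrt_filter)
  qed
  then have res: "residue lam [] M S =
      map (\<lambda>k. rev (filter (\<lambda>c. c \<in> diagonals k) [0..<C])) (rev [1..<Suc M])"
    unfolding residue_def diag by simp
  have fp: "factor_pairs (residue lam [] M S) =
      concat (map (\<lambda>k. map (Pair k) (rev (filter (\<lambda>c. c \<in> diagonals k) [0..<C]))) (rev [1..<Suc M]))"
    unfolding factor_pairs_def res
    by (simp only: length_map length_rev length_upt diff_Suc_1 zip_map2 zip_same_conv_map map_map comp_def split_beta fst_conv snd_conv)
  have final: "foldr star_step (factor_pairs (residue lam [] M S)) (replicate (length S) [], replicate (length S) []) = star_state S"
    using part_svt_all[OF C, of M] initial_state[of "length S"] unfolding fp part_svt_initial part_svt_final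
    by simp
  obtain n' where n': "uncrowded S = snd (star_insertion (residue lam [] M S)) @ replicate n' []"
    using foldr_star_step_pad[of "factor_pairs (residue lam [] M S)" "length S"] final
    unfolding star_insertion_def star_state_def by auto
  \<comment> \<open>Every row of \<open>S\<close> is nonempty, hence so is every row of its
    uncrowding, and no padding can remain.\<close>
  then have "n' = 0" using uncrowded_nonempty[OF pos] by (cases n') auto
  then show ?thesis using n' by simp
qed

end

subsection \<open>Uncrowding by rows\<close>

abbreviation singletons :: "nat list list \<Rightarrow> nat set list list" where
  "singletons \<equiv> map (map (\<lambda>a. {a}))"

lemma subst_first_update:
  "k < length R \<Longrightarrow> R ! k = y \<Longrightarrow> \<forall>i<k. R ! i \<noteq> y \<Longrightarrow> R[k := x] = subst_first y x R"
proof (induction R arbitrary: k)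
  case (Cons z R)
  show ?case
  proof (cases k)
    case 0
    then show ?thesis using Cons.prems by simp
  next
    case (Suc k')
    have "z \<noteq> y" using Cons.prems(3) Suc by force
    moreover have "\<forall>i<k'. R ! i \<noteq> y" using Cons.prems(3) Suc by force
    ultimately show ?thesis using Cons.IH[of k'] Cons.prems Suc by simp
  qed
qed simp

lemma bump_row_singletons:
  "bump_row x (map (\<lambda>a. {a}) R) = map_prod (map (\<lambda>a. {a})) id (row_bump x R)"
proof (cases "\<exists>y\<in>set R. x < y")
  case False
  then have "{y \<in> \<Union>(set (map (\<lambda>a. {a}) R)). x < y} = {}" by auto
  then show ?thesis using False unfolding bump_row_def row_bump_def Let_def by simp
next
  case True
  define y where "y = Min {y \<in> set R. x < y}"
  define k where "k = Min {k \<in> {..<length (map (\<lambda>a. {a}) R)}. y \<in> map (\<lambda>a. {a}) R ! k}"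
  have G: "{y \<in> \<Union>(set (map (\<lambda>a. {a}) R)). x < y} = {y \<in> set R. x < y}" by auto
  have ne: "{y \<in> set R. x < y} \<noteq> {}" using True by auto
  have y: "y \<in> set R" using Min_greater(1)[OF True] unfolding y_def .
  let ?K = "{k. k < length R \<and> R ! k = y}"
  have "{k \<in> {..<length (map (\<lambda>a. {a}) R)}. y \<in> map (\<lambda>a. {a}) R ! k} = ?K" by auto
  then have k_def': "k = Min ?K" unfolding k_def by simp
  have "?K \<noteq> {}" using y by (auto simp: in_set_conv_nth)
  then have "k \<in> ?K" unfolding k_def' by (intro Min_in) auto
  then have k: "k < length R" "R ! k = y" by auto
  have "R ! i \<noteq> y" if "i < k" for i
  proof
    assume "R ! i = y"
    then have "i \<in> ?K" using that k(1) by auto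
    then have "Min ?K \<le> i" by (intro Min_le) auto
    then have "k \<le> i" unfolding k_def' .
    with that show False by (meson leD)
  qed
  then have upd: "R[k := x] = subst_first y x R" by (intro subst_first_update[OF k]) simp
  have "(map (\<lambda>a. {a}) R)[k := insert x (map (\<lambda>a. {a}) R ! k - {y})] = map (\<lambda>a. {a}) (R[k := x])"
    using k by (simp add: map_update)
  then show ?thesis
    using True ne unfolding bump_row_def row_bump_def Let_def G y_def[symmetric] k_def[symmetric] upd
    by simp
qed

lemma bump_rows_singletons: "bump_rows x (singletons V) = singletons (fst (ins_rows x V))"
proof (induction V arbitrary: x)
  case (Cons R V)
  obtain R' o' where "row_bump x R = (R', o')" by fastforce
  then show ?case
    using Cons by (cases o') (auto simp: bump_row_singletons case_prod_beta)
qed simp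

lemma extras_append: "extras (R1 @ R2) = extras R2 @ extras R1"
  unfolding extras_def by simp

lemma extras_singletons: "\<forall>A\<in>set R. \<exists>a. A = {a} \<Longrightarrow> extras R = []"
  unfolding extras_def by fastforce

lemma uncrowded_singletons: "uncrowded (singletons V) = V"
  by (induction V) (auto simp: extras_singletons comp_def)

lemma uncrowded_append_cong:
  "uncrowded Z = uncrowded Z' \<Longrightarrow> uncrowded (X @ Z) = uncrowded (X @ Z')"
  by (induction X) auto

definition row_ordered :: "nat set list \<Rightarrow> bool" where
  "row_ordered R \<longleftrightarrow> sorted_wrt (\<lambda>A B. \<forall>a\<in>A. \<forall>b\<in>B. a \<le> b) R"

lemma not_multicell: "finite A \<Longrightarrow> A \<noteq> {} \<Longrightarrow> \<not> multicell A \<Longrightarrow> \<exists>a. A = {a}"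
  unfolding multicell_def by (metis One_nat_def Suc_lessI card_1_singletonE card_gt_0_iff)

text \<open>The letter \<open>x\<close> is the maximum of the last multicell. The cells to its right
  are singletons and contribute no extra letters, so \<open>x\<close> heads
  \<open>extras R\<close>.\<close>

lemma crowded_row:
  assumes fin: "\<forall>A\<in>set R. finite A \<and> A \<noteq> {}" and ord: "row_ordered R"
    and multi: "\<exists>A\<in>set R. multicell A"
  defines "x \<equiv> Max (\<Union>{A \<in> set R. multicell A})"
  defines "R' \<equiv> map (\<lambda>A. if multicell A then A - {x} else A) R"
  shows "extras R = x # extras R'" and "map Min R' = map Min R"
    and "\<forall>A\<in>set R'. finite A \<and> A \<noteq> {}" and "row_ordered R'"
proof -
  obtain R1 A R2 where R: "R = R1 @ A # R2" and A: "multicell A" and R2: "\<forall>B\<in>set R2. \<not> multicell B"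
    using split_list_last_prop[OF multi] by blast
  have finA: "finite A" "A \<noteq> {}" using fin R by auto
  have R1A: "b \<le> a" if "B \<in> set R1" "b \<in> B" "a \<in> A" for B b a
  proof -
    have "\<forall>B\<in>set R1. \<forall>C\<in>set (A # R2). \<forall>b\<in>B. \<forall>c\<in>C. b \<le> c"
      using ord unfolding R row_ordered_def sorted_wrt_append by blast
    then show ?thesis using that by (meson list.set_intros(1))
  qed
  have x: "x = Max A"
    unfolding x_def
  proof (rule Max_eqI)
    show "finite (\<Union>{A \<in> set R. multicell A})"
      by (rule finite_Union) (use fin in \<open>simp_all\<close>)
    have "Max A \<in> A" using finA by (rule Max_in)
    moreover have "A \<in> {A \<in> set R. multicell A}" using A R by simp
    ultimately show "Max A \<in> \<Union>{A \<in> set R. multicell A}" by blast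
    fix y assume "y \<in> \<Union>{A \<in> set R. multicell A}"
    then obtain B where B: "B \<in> set R" "multicell B" "y \<in> B" by auto
    then have "B \<in> set R1 \<or> B = A" using R R2 by auto
    then show "y \<le> Max A" using B R1A[of B y "Max A"] finA by auto
  qed
  have xA: "x \<in> A" using x finA by simp
  have neA: "A - {x} \<noteq> {}"
  proof
    assume "A - {x} = {}"
    then have "A = {x}" using xA by auto
    then show False using A unfolding multicell_def by auto
  qed
  have ltA: "\<forall>a\<in>A - {x}. a < x" using x finA by (auto simp: le_neq_implies_less)
  \<comment> \<open>The multicell has a letter below \<open>x\<close>, and this letter bounds all
    cells to its left.\<close>
  have R1: "x \<notin> B" if "B \<in> set R1" for B
  proof -
    obtain a where a: "a \<in> A - {x}" using neA by auto
    then have "a < x" using ltA by blast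
    then show ?thesis using R1A[OF that, of x a] a by auto
  qed
  have R': "R' = R1 @ (A - {x}) # R2"
    using R1 R2 A unfolding R'_def R by (auto simp: map_idI)
  have "\<forall>B\<in>set R2. \<exists>b. B = {b}"
  proof
    fix B assume B: "B \<in> set R2"
    then have "finite B" "B \<noteq> {}" "\<not> multicell B" using fin R R2 by auto
    then show "\<exists>b. B = {b}" by (rule not_multicell)
  qed
  then have ex2: "extras R2 = []" by (rule extras_singletons)
  have ins: "insert x (A - {x}) = A" using xA by auto
  have "extras (R1 @ [A]) = x # extras (R1 @ [A - {x}])" "Min A = Min (A - {x})"
    using extras_insert_max[of "A - {x}" x] finA neA ltA unfolding ins by simp_all
  then show "extras R = x # extras R'" "map Min R' = map Min R"
    using ex2 extras_append[of "R1 @ [A]" R2] extras_append[of "R1 @ [A - {x}]" R2]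
    unfolding R R' by auto
  show "\<forall>A\<in>set R'. finite A \<and> A \<noteq> {}" using fin neA unfolding R R' by auto
  show "row_ordered R'" using ord unfolding R R' row_ordered_def by (auto simp: sorted_wrt_append)
qed

text \<open>
  Bumping is only known to keep a row single-valued, so the order within a row is recorded only
  as long as the row has not been bumped.
\<close>

definition uncrowdable :: "nat set list list \<Rightarrow> bool" where
  "uncrowdable T \<longleftrightarrow> (\<forall>R\<in>set T. (\<forall>A\<in>set R. finite A \<and> A \<noteq> {}) \<and>
     (row_ordered R \<or> (\<forall>A\<in>set R. \<exists>a. A = {a})))"

lemma singletons_ex:
  assumes "\<forall>R\<in>set T. \<forall>A\<in>set R. \<exists>a. A = {a}"
  shows "T = singletons (uncrowded T)"
proof -
  have "map (\<lambda>a. {a}) (map the_elem R) = R" if "R \<in> set T" for R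
    unfolding map_map using assms that by (intro map_idI) force
  then have T: "singletons (map (map the_elem) T) = T"
    unfolding map_map by (intro map_idI) simp
  show ?thesis using uncrowded_singletons[of "map (map the_elem) T"] unfolding T by (simp only: T)
qed

text \<open>One uncrowding performs the first insertion prescribed by \<open>extras\<close> of the
  topmost crowded row. The rows above are single-valued and stay so; hence \<open>uncrowded\<close>
  is invariant while one extra letter disappears.\<close>

lemma uncrowd_step_props:
  assumes T: "uncrowdable T" and multi: "has_multicell T"
  shows "uncrowdable (uncrowd_step T)" and "uncrowded (uncrowd_step T) = uncrowded T"
    and "sum_list (map (length \<circ> extras) (uncrowd_step T)) < sum_list (map (length \<circ> extras) T)"
proof -
  let ?M = "{r \<in> {..<length T}. \<exists>A \<in> set (T ! r). multicell A}"
  define r where "r = Max ?M"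
  define x where "x = Max (\<Union>{A \<in> set (T ! r). multicell A})"
  define R' where "R' = map (\<lambda>A. if multicell A then A - {x} else A) (T ! r)"
  let ?V = "drop (Suc r) T"
  have "?M \<noteq> {}"
  proof -
    obtain R where "R \<in> set T" "\<exists>A\<in>set R. multicell A" using multi unfolding has_multicell_def by blast
    moreover from this obtain i where "i < length T" "R = T ! i" by (metis in_set_conv_nth)
    ultimately show ?thesis by blast
  qed
  then have "r \<in> ?M" unfolding r_def by (intro Max_in) auto
  then have r: "r < length T" "\<exists>A \<in> set (T ! r). multicell A" by auto
  have above: "\<exists>a. A = {a}" if q: "R \<in> set ?V" "A \<in> set R" for R A
  proof -
    obtain i where i: "i < length T - Suc r" "R = T ! (Suc r + i)"
      using q(1) by (auto simp: in_set_conv_nth)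
    have "Suc r + i \<notin> ?M"
    proof
      assume "Suc r + i \<in> ?M"
      then have "Suc r + i \<le> r" unfolding r_def by (intro Max_ge) auto
      then show False by simp
    qed
    then have "\<not> multicell A" using i q(2) by auto
    moreover have "R \<in> set T" using q(1) by (rule in_set_dropD)
    ultimately show ?thesis using T q(2) not_multicell unfolding uncrowdable_def by blast
  qed
  then have V: "?V = singletons (uncrowded ?V)" by (intro singletons_ex) auto
  obtain W where W: "?V = singletons W" using V by blast
  have split: "T = take r T @ T ! r # singletons W"
    using id_take_nth_drop[OF r(1)] unfolding W .
  have step: "uncrowd_step T = take r T @ R' # singletons (fst (ins_rows x W))"
    unfolding uncrowd_step_def Let_def r_def[symmetric] x_def[symmetric] R'_def[symmetric] W
      bump_rows_singletons ..
  have Tr: "T ! r \<in> set T" using r by simp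
  have "row_ordered (T ! r)"
    using T Tr r(2) unfolding uncrowdable_def multicell_def by fastforce
  moreover have "\<forall>A\<in>set (T ! r). finite A \<and> A \<noteq> {}" using T Tr unfolding uncrowdable_def by auto
  ultimately have R': "extras (T ! r) = x # extras R'" "map Min R' = map Min (T ! r)"
    "\<forall>A\<in>set R'. finite A \<and> A \<noteq> {}" "row_ordered R'"
    using crowded_row[of "T ! r"] r(2) unfolding x_def[symmetric] R'_def[symmetric] by blast+
  have "\<forall>R\<in>set (take r T). (\<forall>A\<in>set R. finite A \<and> A \<noteq> {}) \<and> (row_ordered R \<or> (\<forall>A\<in>set R. \<exists>a. A = {a}))"
    using T unfolding uncrowdable_def by (meson in_set_takeD)
  then show "uncrowdable (uncrowd_step T)"
    using R'(3,4) unfolding step uncrowdable_def by auto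
  have "uncrowded (R' # singletons (fst (ins_rows x W))) = uncrowded (T ! r # singletons W)"
    using R'(1,2) by (simp add: uncrowded_singletons case_prod_beta)
  then show "uncrowded (uncrowd_step T) = uncrowded T"
    unfolding step by (subst (2) split) (rule uncrowded_append_cong)
  have zero: "sum_list (map (length \<circ> extras) (singletons U)) = 0" for U
    by (auto simp: extras_singletons)
  have "sum_list (map (length \<circ> extras) T) =
     sum_list (map (length \<circ> extras) (take r T)) + length (extras (T ! r))"
    by (subst split) (simp only: map_append sum_list_append list.map sum_list.Cons zero o_apply add_0_right)
  moreover have "sum_list (map (length \<circ> extras) (uncrowd_step T)) =
     sum_list (map (length \<circ> extras) (take r T)) + length (extras R')"
    unfolding step by (simp only: map_append sum_list_append list.map sum_list.Cons zero o_apply add_0_right)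
  ultimately show "sum_list (map (length \<circ> extras) (uncrowd_step T)) < sum_list (map (length \<circ> extras) T)"
    using R'(1) by simp
qed

text \<open>The loop terminates because the number of extra letters decreases, and on singletons the
  invariant \<open>uncrowded\<close> just reads off the letters.\<close>

lemma uncrowd_P_eq_uncrowded:
  assumes "uncrowdable T"
  shows "uncrowd_P T = uncrowded T"
proof -
  have "while has_multicell uncrowd_step T = singletons (uncrowded T)"
    using assms
  proof (induction "sum_list (map (length \<circ> extras) T)" arbitrary: T rule: less_induct)
    case less
    show ?case
    proof (cases "has_multicell T")
      case True
      then show ?thesis
        using less.hyps uncrowd_step_props[OF less.prems True] by (subst while_unfold) simp
    next
      case False
      then have "\<forall>R\<in>set T. \<forall>A\<in>set R. \<exists>a. A = {a}"
        using less.prems not_multicell unfolding has_multicell_def uncrowdable_def by blast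
      then show ?thesis using False singletons_ex by (subst while_unfold) simp
    qed
  qed
  then show ?thesis unfolding uncrowd_P_def by (simp add: comp_def)
qed

subsection \<open>Filling the inner shape\<close>

text \<open>The starting row \<open>i\<close> lets the filling follow the recursion of
  \<open>ins_rows\<close> and \<open>uncrowded\<close>.\<close>

fun fill_rows :: "nat list \<Rightarrow> nat \<Rightarrow> nat list list \<Rightarrow> nat list list" where
  "fill_rows mu i [] = []"
| "fill_rows mu i (R # V) =
     (replicate (part mu i) (Suc i) @ map (\<lambda>a. a + length mu) R) # fill_rows mu (Suc i) V"

fun fill_sets :: "nat list \<Rightarrow> nat \<Rightarrow> nat set list list \<Rightarrow> nat set list list" where
  "fill_sets mu i [] = []"
| "fill_sets mu i (R # V) =
     (replicate (part mu i) {Suc i} @ map (\<lambda>A. (\<lambda>a. a + length mu) ` A) R) # fill_sets mu (Suc i) V"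

lemma fill_sets_conv:
  "fill_sets mu i T =
     map (\<lambda>r. replicate (part mu (i + r)) {Suc (i + r)} @ map (\<lambda>A. (\<lambda>a. a + length mu) ` A) (T ! r))
       [0..<length T]"
proof (induction T arbitrary: i)
  case (Cons R T)
  have "[0..<length (R # T)] = 0 # map Suc [0..<length T]"
    by (simp add: upt_conv_Cons map_Suc_upt del: upt_Suc)
  then show ?case using Cons by (simp add: comp_def del: upt_Suc)
qed simp

lemma fill_inner_conv: "fill_inner mu T = fill_sets mu 0 T"
  unfolding fill_inner_def fill_sets_conv by simp

lemma length_fill_rows [simp]: "length (fill_rows mu i V) = length V"
  by (induction V arbitrary: i) auto

lemma fill_rows_nth:
  "r < length V \<Longrightarrow>
   fill_rows mu i V ! r = replicate (part mu (i + r)) (Suc (i + r)) @ map (\<lambda>a. a + length mu) (V ! r)"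
proof (induction V arbitrary: i r)
  case (Cons R V)
  then show ?case by (cases r) auto
qed simp

lemma delete_inner_fill_rows:
  "map (map (\<lambda>q. q - length mu)) (delete_inner mu (fill_rows mu 0 V)) = V"
  by (rule nth_equalityI) (auto simp: delete_inner_def fill_rows_nth comp_def)

lemma subst_first_shift:
  "subst_first (y + m) (x + m) (map (\<lambda>a. a + m) R) = map (\<lambda>a. a + m) (subst_first y x (R :: nat list))"
  by (induction R) auto

text \<open>Letters of the inner shape never exceed the inserted \<open>x + m\<close>, so they are
  never bumped.\<close>

lemma row_bump_shift:
  assumes "n = 0 \<or> s \<le> m"
  shows "row_bump (x + m) (replicate n s @ map (\<lambda>a. a + m) R) =
    (replicate n s @ map (\<lambda>a. a + m) (fst (row_bump x R)), map_option (\<lambda>a. a + m) (snd (row_bump x R)))"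
proof -
  let ?L = "replicate n s @ map (\<lambda>a. a + m) R"
  have G: "{z \<in> set ?L. x + m < z} = (\<lambda>a. a + m) ` {y \<in> set R. x < y}" using assms by auto
  show ?thesis
  proof (cases "\<exists>y\<in>set R. x < y")
    case True
    let ?y = "Min {y \<in> set R. x < y}"
    have "Min {z \<in> set ?L. x + m < z} = ?y + m"
      unfolding G using True by (subst mono_Min_commute[symmetric]) (auto simp: mono_def)
    moreover have "\<exists>z\<in>set ?L. x + m < z" using True G by blast
    moreover have "?y + m \<notin> set (replicate n s)" using assms Min_greater(2)[OF True] by auto
    ultimately show ?thesis
      using True unfolding row_bump_def by (auto simp: Let_def subst_first_append subst_first_shift)
  next
    case False
    then have "\<not> (\<exists>z\<in>set ?L. x + m < z)" using G by blast
    then show ?thesis using False unfolding row_bump_def by simp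
  qed
qed

lemma part_pos: "part mu i = 0 \<or> Suc i \<le> length mu"
  unfolding part_def by auto

lemma ins_rows_fill:
  assumes "length mu \<le> i + length V"
  shows "ins_rows (x + length mu) (fill_rows mu i V) = map_prod (fill_rows mu i) id (ins_rows x V)"
  using assms
proof (induction V arbitrary: x i)
  case Nil
  \<comment> \<open>A row created on top lies above all parts of \<open>mu\<close>, so it receives
    no inner cells.\<close>
  then have "part mu i = 0" using part_pos[of mu i] by auto
  then show ?case by simp
next
  case (Cons R V)
  obtain R' o' where b: "row_bump x R = (R', o')" by fastforce
  show ?case
    using row_bump_shift[OF part_pos[of mu i], of x R] b Cons.IH[of "Suc i" "the o'"] Cons.prems
    by (cases o') (auto simp: case_prod_beta map_prod_def)
qed

lemma ins_word_fill:
  assumes "length mu \<le> i + length V"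
  shows "fst (ins_word (map (\<lambda>a. a + length mu) xs) (fill_rows mu i V)) =
         fill_rows mu i (fst (ins_word xs V))"
  using assms
proof (induction xs arbitrary: V)
  case (Cons x xs)
  obtain V' s where V': "ins_rows x V = (V', s)" by fastforce
  have "length V \<le> length V'" using row_len_ins_rows[OF V'] by auto
  then have "length mu \<le> i + length V'" using Cons.prems by auto
  from Cons.IH[OF this] show ?case
    using ins_rows_fill[OF Cons.prems, of x] V' by (simp add: case_prod_beta)
qed simp

lemma extras_fill:
  assumes "\<forall>A\<in>set R. finite A \<and> A \<noteq> {}"
  shows "extras (replicate n {s} @ map (\<lambda>A. (\<lambda>a. a + m) ` A) R) = map (\<lambda>a. a + m) (extras R)"
proof -
  have mn: "Min ((\<lambda>a. a + m) ` A) = Min A + m" if "finite A" "A \<noteq> {}" for A :: "nat set"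
    using that by (subst mono_Min_commute[symmetric]) (auto simp: mono_def)
  have sl: "sorted_list_of_set ((\<lambda>a. a + m) ` B) = map (\<lambda>a. a + m) (sorted_list_of_set B)"
    if "finite B" for B :: "nat set"
    using that sorted_list_of_set.idem_if_sorted_distinct[of "map (\<lambda>a. a + m) (sorted_list_of_set B)"]
    by (simp add: sorted_wrt_map distinct_map)
  have "sorted_list_of_set ((\<lambda>a. a + m) ` A - {Min ((\<lambda>a. a + m) ` A)}) =
      map (\<lambda>a. a + m) (sorted_list_of_set (A - {Min A}))" if "finite A" "A \<noteq> {}" for A :: "nat set"
  proof -
    have "(\<lambda>a. a + m) ` A - {Min ((\<lambda>a. a + m) ` A)} = (\<lambda>a. a + m) ` (A - {Min A})"
      using mn[OF that] by auto
    then show ?thesis using sl that by simp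
  qed
  then have "extras (map (\<lambda>A. (\<lambda>a. a + m) ` A) R) = map (\<lambda>a. a + m) (extras R)"
    using assms unfolding extras_def map_concat rev_map map_map comp_def
    by (intro arg_cong[where f = concat] map_cong refl) (simp add: rev_map)
  moreover have "extras (replicate n {s}) = []" by (rule extras_singletons) auto
  ultimately show ?thesis by (simp add: extras_append)
qed

lemma uncrowded_fill:
  assumes "\<forall>R\<in>set T. \<forall>A\<in>set R. finite A \<and> A \<noteq> {}" and "length mu \<le> i + length T"
  shows "uncrowded (fill_sets mu i T) = fill_rows mu i (uncrowded T)"
  using assms
proof (induction T arbitrary: i)
  case (Cons R T)
  have "length mu \<le> Suc i + length (uncrowded T)"
    using length_uncrowded[of T] Cons.prems by auto
  then have "fst (ins_word (map (\<lambda>a. a + length mu) (extras R)) (fill_rows mu (Suc i) (uncrowded T))) =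
      fill_rows mu (Suc i) (fst (ins_word (extras R) (uncrowded T)))"
    by (rule ins_word_fill)
  moreover have "Min ((\<lambda>a. a + length mu) ` A) = Min A + length mu" if "A \<in> set R" for A
    using that Cons.prems by (subst mono_Min_commute[symmetric]) (auto simp: mono_def)
  moreover have "extras (replicate (part mu i) {Suc i} @ map (\<lambda>A. (\<lambda>a. a + length mu) ` A) R) =
      map (\<lambda>a. a + length mu) (extras R)"
    using Cons.prems by (intro extras_fill) auto
  ultimately show ?case using Cons by (simp add: comp_def)
qed simp

section \<open>From the skew tableau to the filled straight one\<close>

lemma part_antitone:
  assumes "is_partition lam"
  shows "part lam (Suc r) \<le> part lam r"
  using assms unfolding is_partition_def part_def by (auto simp: sorted_wrt_iff_nth_less)

lemma SVT_fill_inner: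
  assumes lam: "is_partition lam" and mu: "is_partition mu" and sub: "subpartition mu lam"
    and T: "T \<in> SVT m lam mu"
  defines "S \<equiv> fill_inner mu T"
  shows "straight_svt (m + length mu) S" and "length S = length lam"
    and "\<And>r. r < length S \<Longrightarrow> lam ! r = length (S ! r)"
    and "[] \<notin> set S" and "length mu \<le> length T" and "uncrowdable T"
proof -
  let ?n = "length mu"
  have lenT: "length T = length lam"
    and rowT: "\<And>r. r < length lam \<Longrightarrow> length (T ! r) = part lam r - part mu r"
    and cellT: "\<And>r c. (r, c) \<in> skew_cells lam mu \<Longrightarrow> entry mu T (r, c) \<noteq> {} \<and> entry mu T (r, c) \<subseteq> {1..m}"
    and hor: "\<And>r c. (r, c) \<in> skew_cells lam mu \<Longrightarrow> (r, Suc c) \<in> skew_cells lam mu \<Longrightarrow>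
        Max (entry mu T (r, c)) \<le> Min (entry mu T (r, Suc c))"
    and ver: "\<And>r c. (r, c) \<in> skew_cells lam mu \<Longrightarrow> (Suc r, c) \<in> skew_cells lam mu \<Longrightarrow>
        Max (entry mu T (r, c)) < Min (entry mu T (Suc r, c))"
    using T unfolding SVT_def by blast+
  have ml: "part mu r \<le> part lam r" for r using sub unfolding subpartition_def by auto
  have posl: "0 < part lam r" if "r < length lam" for r
    using lam that unfolding is_partition_def part_def by (auto simp: in_set_conv_nth)
  have posm: "r < ?n" if "0 < part mu r" for r
    using that unfolding part_def by (auto split: if_splits)
  show len: "length S = length lam" unfolding S_def fill_inner_def using lenT by simp
  have Sr: "S ! r = replicate (part mu r) {Suc r} @ map (\<lambda>A. (\<lambda>a. a + ?n) ` A) (T ! r)" if "r < length lam" for r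
    using that lenT unfolding S_def fill_inner_def by simp
  have lenr: "length (S ! r) = part lam r" if "r < length lam" for r
    using Sr[OF that] rowT[OF that] ml[of r] by simp
  show "lam ! r = length (S ! r)" if "r < length S" for r
    using lenr[of r] that len unfolding part_def by auto
  show "[] \<notin> set S" using lenr posl len by (fastforce simp: in_set_conv_nth)
  show mulen: "?n \<le> length T"
  proof (rule ccontr)
    assume "\<not> ?n \<le> length T"
    then have "0 < part mu (length lam)"
      using mu lenT unfolding is_partition_def part_def by (auto simp: in_set_conv_nth)
    then show False using ml[of "length lam"] unfolding part_def by auto
  qed
  have inner: "S ! r ! c = {Suc r}" if "r < length lam" "c < part mu r" for r c
    using Sr[OF that(1)] that(2) by (simp add: nth_append)
  have skew: "(r, c) \<in> skew_cells lam mu \<longleftrightarrow> r < length lam \<and> part mu r \<le> c \<and> c < part lam r" for r c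
    unfolding skew_cells_def by auto
  have outer: "S ! r ! c = (\<lambda>a. a + ?n) ` entry mu T (r, c)" if "(r, c) \<in> skew_cells lam mu" for r c
    using Sr[of r] that rowT[of r] unfolding skew entry_def by (auto simp: nth_append)
  have fin: "finite (entry mu T z)" if "z \<in> skew_cells lam mu" for z
    using cellT that by (metis finite_atLeastAtMost finite_subset surj_pair)
  have svt: "straight_svt (m + ?n) S"
  proof
    fix r c assume r: "r < length S" and c: "c < length (S ! r)"
    then have rl: "r < length lam" "c < part lam r" using len lenr by auto
    show "S ! r ! c \<noteq> {} \<and> S ! r ! c \<subseteq> {1..m + ?n}"
    proof (cases "c < part mu r")
      case True
      then show ?thesis using inner[OF rl(1) True] posm[of r] by auto
    next
      case False
      then have z: "(r, c) \<in> skew_cells lam mu" using rl skew by auto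
      then show ?thesis using outer[OF z] cellT[OF z] by fastforce
    qed
  next
    fix r assume "Suc r < length S"
    then show "length (S ! Suc r) \<le> length (S ! r)" using lenr len part_antitone[OF lam] by auto
  next
    fix r c a b assume r: "r < length S" and c: "Suc c < length (S ! r)"
      and a: "a \<in> S ! r ! c" and b: "b \<in> S ! r ! Suc c"
    then have rl: "r < length lam" "Suc c < part lam r" using len lenr by auto
    \<comment> \<open>Both cells are inner, or the pair crosses the border, or both are outer.
      Across the border, inner letters are at most \<open>?n\<close> and outer letters exceed
      it.\<close>
    consider "Suc c < part mu r" | "c < part mu r" "(r, Suc c) \<in> skew_cells lam mu"
      | "(r, c) \<in> skew_cells lam mu" "(r, Suc c) \<in> skew_cells lam mu"
      using rl skew by fastforce
    then show "a \<le> b"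
    proof cases
      case 1
      then show ?thesis using inner[OF rl(1), of c] inner[OF rl(1), of "Suc c"] a b by auto
    next
      case 2
      then show ?thesis
        using inner[OF rl(1), of c] outer[OF 2(2)] cellT[OF 2(2)] posm[of r] a b by fastforce
    next
      case 3
      obtain a' b' where "a = a' + ?n" "a' \<in> entry mu T (r, c)" "b = b' + ?n" "b' \<in> entry mu T (r, Suc c)"
        using outer[OF 3(1)] outer[OF 3(2)] a b by auto
      then show ?thesis
        using hor[OF 3] Max_ge[OF fin[OF 3(1)], of a'] Min_le[OF fin[OF 3(2)], of b'] by linarith
    qed
  next
    fix r c a b assume r: "Suc r < length S" and c: "c < length (S ! Suc r)"
      and a: "a \<in> S ! r ! c" and b: "b \<in> S ! Suc r ! c"
    then have rl: "Suc r < length lam" "r < length lam" "c < part lam (Suc r)" "c < part lam r"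
      using len lenr[of "Suc r"] part_antitone[OF lam, of r] by auto
    consider "c < part mu (Suc r)" "c < part mu r" | "c < part mu r" "(Suc r, c) \<in> skew_cells lam mu"
      | "(r, c) \<in> skew_cells lam mu" "(Suc r, c) \<in> skew_cells lam mu"
      using rl skew part_antitone[OF mu, of r] by fastforce
    then show "a < b"
    proof cases
      case 1
      then show ?thesis using inner[OF rl(2), of c] inner[OF rl(1), of c] a b by auto
    next
      case 2
      then show ?thesis
        using inner[OF rl(2), of c] outer[OF 2(2)] cellT[OF 2(2)] posm[of r] a b by fastforce
    next
      case 3
      obtain a' b' where "a = a' + ?n" "a' \<in> entry mu T (r, c)" "b = b' + ?n" "b' \<in> entry mu T (Suc r, c)"
        using outer[OF 3(1)] outer[OF 3(2)] a b by auto
      then show ?thesis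
        using ver[OF 3] Max_ge[OF fin[OF 3(1)], of a'] Min_le[OF fin[OF 3(2)], of b'] by linarith
    qed
  qed
  then show "straight_svt (m + ?n) S" .
  have Tcell: "S ! r ! (part mu r + j) = (\<lambda>a. a + ?n) ` (T ! r ! j)" "(r, part mu r + j) \<in> skew_cells lam mu"
    "entry mu T (r, part mu r + j) = T ! r ! j"
    if "r < length lam" "j < length (T ! r)" for r j
    using Sr[OF that(1)] that rowT[OF that(1)] unfolding skew entry_def by (auto simp: nth_append)
  show "uncrowdable T"
    unfolding uncrowdable_def
  proof
    fix R assume "R \<in> set T"
    then obtain r where r: "r < length lam" "R = T ! r" using lenT by (auto simp: in_set_conv_nth)
    have "finite A \<and> A \<noteq> {}" if "A \<in> set R" for A
      using that r Tcell(2,3)[OF r(1)] cellT fin by (metis in_set_conv_nth)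
    moreover have "row_ordered R"
      unfolding row_ordered_def sorted_wrt_iff_nth_less
    proof (intro allI impI ballI)
      fix i j a b assume ij: "i < j" "j < length R" and a: "a \<in> R ! i" and b: "b \<in> R ! j"
      \<comment> \<open>The order along rows of \<open>T\<close> is read off from the filled
        tableau, where it holds between any two columns.\<close>
      have "a + ?n \<le> b + ?n"
        using straight_svt.row_le[OF svt, of "part mu r + i" "part mu r + j" r "a + ?n" "b + ?n"]
          ij a b r len lenr[OF r(1)] rowT[OF r(1)] Tcell(1)[OF r(1)] by auto
      then show "a \<le> b" by simp
    qed
    ultimately show "(\<forall>A\<in>set R. finite A \<and> A \<noteq> {}) \<and> (row_ordered R \<or> (\<forall>A\<in>set R. \<exists>a. A = {a}))"
      by blast
  qed
qed

theorem theorem4p29: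
  fixes lam mu :: "nat list" and m :: nat and T :: "nat set list list"
    and P Q :: "nat list list"
  assumes "is_partition lam" and "is_partition mu" and "subpartition mu lam"
    and "T \<in> SVT m lam mu"
    and "(P, Q) = mod_star_residue lam mu m T"
  shows "Q = uncrowd_P T"
proof -
  note facts = SVT_fill_inner[OF assms(1-4)]
  have "snd (star_insertion (residue lam [] (m + length mu) (fill_inner mu T))) =
        uncrowded (fill_inner mu T)"
    using straight_svt.star_insertion_residue[OF facts(1) facts(2)[symmetric] facts(3,4)] .
  also have "\<dots> = fill_rows mu 0 (uncrowded T)"
    unfolding fill_inner_conv using facts(5,6)
    by (intro uncrowded_fill) (auto simp: uncrowdable_def)
  finally have "Q = uncrowded T"
    using assms(5) delete_inner_fill_rows[of mu "uncrowded T"]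
    unfolding mod_star_residue_def by (simp add: case_prod_beta)
  then show ?thesis using uncrowd_P_eq_uncrowded[OF facts(6)] by simp
qed

end
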